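(* Let $P(\lambda):=\lambda^2M+\lambda D+K$, where $0<M=M^*\in\mathbb C^{n\times n}$, $0\le D=D^*\in\mathbb C^{n\times n}$ and $0\le K=K^*\in\mathbb C^{n\times n}$, and let $P_0(\lambda):=\lambda^2M+K$. Let $\omega\in\mathbb R\setminus\{0\}$ and let $i\omega\in\Lambda(P)$ have geometric multiplicity $p$. Consider a QR factorization $$Q^*\begin{bmatrix}P_0(i\omega)&D\end{bmatrix}=\begin{bmatrix}R\\0_{p\times 2n}\end{bmatrix},$$ where $R$ has full row rank and $Q=\begin{bmatrix}Q_1&Q_2\end{bmatrix}$ is unitary with $Q_2\in\mathbb C^{n\times p}$. Then the columns of $Q_2$ span $\mathcal N(P(i\omega))$. Let $0<T=T^*\in\mathbb C^{p\times p}$ and consider the family of matrix polynomials $$\widehat P_t(\lambda):=P(\lambda)+\lambda\,t\,MQ_2TQ_2^*M,\qquad t>0.$$ Then there exists an $M$-unitary matrix $X=\begin{bmatrix}X_1&X_2\end{bmatrix}$ with $X_2:=Q_2(Q_2^*MQ_2)^{-1/2}$ such that for all $t>0$ $$X^*P(\lambda)X=\operatorname{diag}\big(\widetilde P(\lambda),\ (\lambda^2+\omega^2)I_p\big),\qquad X^*\widehat P_t(\lambda)X=\operatorname{diag}\big(\widetilde P(\lambda),\ \lambda^2I_p+\lambda\,t\,\widehat T+\omega^2I_p\big),$$ where $\widehat T:=(Q_2^*MQ_2)^{1/2}T(Q_2^*MQ_2)^{1/2}$ and $\widetilde P(\lambda):=X_1^*P(\lambda)X_1$. Furthermore, $\Lambda(\widetilde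 P)=\Lambda(P)\setminus\{\pm i\omega\}$, and the eigenvalues of $\lambda^2I_p+\lambda\,t\,\widehat T+\omega^2I_p$ have negative real parts for all $t>0$. Thus $\pm i\omega\notin\Lambda(\widehat P_t)$ for all $t>0$. Let $W$ be an $n\times m$ matrix with $\operatorname{rank}(W)=m<p$. Then the damped system $\widetilde P_t(\lambda):=P(\lambda)+\lambda\,t\,WW^*$ has undamped eigenvalues $\pm i\omega$, i.e. $\pm i\omega\in\Lambda(\widetilde P_t)$ for all $t>0$.
   Context: $A^*$ denotes the conjugate transpose; for Hermitian matrices $X>0$ ($X\ge0$) means positive (semi)definite. $\mathcal N(X)$ is the nullspace of $X$. For a square matrix polynomial $R(\lambda)$ with $\det R\not\equiv0$, $\Lambda(R):=\{\lambda\in\mathbb C:\det R(\lambda)=0\}$ is its set of eigenvalues, and the geometric multiplicity of $\mu\in\Lambda(R)$ is $\dim\mathcal N(R(\mu))$. A matrix $X\in\mathbb C^{n\times n}$ is $M$-unitary if $X^*MX=I_n$. For a positive definite matrix $B$, $B^{1/2}$ is its positive definite square root and $B^{-1/2}$ its inverse. The polynomial $\widetilde P_t$ (with subscript $t$) in the last paragraph is a separate object from $\widetilde P$. *)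

theory Defs
  imports
    Complex_Main
    "Jordan_Normal_Form.DL_Rank"
    "Jordan_Normal_Form.Matrix_Kernel"
    "Jordan_Normal_Form.Gauss_Jordan_Elimination"
    "Jordan_Normal_Form.Schur_Decomposition"
begin

(* The form (A v) . conj v equals v^* A v. The order on complex numbers is the library one:
   0 < z and 0 \<le> z include that z is real. *)

definition pos_def :: "nat \<Rightarrow> complex mat \<Rightarrow> bool" where
  "pos_def n A \<longleftrightarrow> A \<in> carrier_mat n n \<and> mat_adjoint A = A \<and>
     (\<forall>v \<in> carrier_vec n. v \<noteq> 0\<^sub>v n \<longrightarrow> 0 < (A *\<^sub>v v) \<bullet>c v)"

definition pos_semidef :: "nat \<Rightarrow> complex mat \<Rightarrow> bool" where
  "pos_semidef n A \<longleftrightarrow> A \<in> carrier_mat n n \<and> mat_adjoint A = A \<and>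
     (\<forall>v \<in> carrier_vec n. 0 \<le> (A *\<^sub>v v) \<bullet>c v)"

(* Only used for positive definite B, where the root exists and is unique. *)

definition mat_sqrt :: "complex mat \<Rightarrow> complex mat" where
  "mat_sqrt B = (THE S. pos_def (dim_row B) S \<and> S * S = B)"

definition mat_inv_sqrt :: "complex mat \<Rightarrow> complex mat" where
  "mat_inv_sqrt B = the (mat_inverse (mat_sqrt B))"

definition m_unitary :: "nat \<Rightarrow> complex mat \<Rightarrow> complex mat \<Rightarrow> bool" where
  "m_unitary n M X \<longleftrightarrow> X \<in> carrier_mat n n \<and> mat_adjoint X * M * X = 1\<^sub>m n"

definition unitary_mat :: "nat \<Rightarrow> complex mat \<Rightarrow> bool" where
  "unitary_mat n Q \<longleftrightarrow> Q \<in> carrier_mat n n \<and> mat_adjoint Q * Q = 1\<^sub>m n"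

(* The block row [A B]: the lower two blocks have no rows. *)

definition block_row :: "'a :: zero mat \<Rightarrow> 'a mat \<Rightarrow> 'a mat" where
  "block_row A B = four_block_mat A B (0\<^sub>m 0 (dim_col A)) (0\<^sub>m 0 (dim_col B))"

definition quad_poly :: "complex mat \<Rightarrow> complex mat \<Rightarrow> complex mat \<Rightarrow> complex \<Rightarrow> complex mat" where
  "quad_poly M D K z = z\<^sup>2 \<cdot>\<^sub>m M + z \<cdot>\<^sub>m D + K"

(* Matrix polynomials are represented by their evaluation maps. The notion is meant for
   regular R (det R not identically zero), e.g. quadratic R with positive definite leading
   coefficient. If det R vanishes identically, the set below is all of the complex plane. *)

definition eigvals :: "(complex \<Rightarrow> complex mat) \<Rightarrow> complex set" where
  "eigvals R = {z. det (R z) = 0}"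

end

theory Submission
  imports Defs "Jordan_Normal_Form.Spectral_Radius"
begin

text \<open>At \<open>\<plusminus>i\<omega>\<close> the imaginary part of \<open>v\<^sup>* P v\<close> is \<open>\<plusminus>\<omega> v\<^sup>* D v\<close>, so both kernels of \<open>P(\<plusminus>i\<omega>)\<close> equal
  \<open>N(P\<^sub>0(i\<omega>)) \<inter> N(D)\<close>, the left null space of \<open>[P\<^sub>0(i\<omega>) D]\<close>, which the QR factorization exhibits as the
  range of \<open>Q\<^sub>2\<close>. On this range \<open>D = 0\<close> and \<open>K = \<omega>\<^sup>2 M\<close>, so for any \<open>M\<close>-orthonormal complement \<open>X\<^sub>1\<close> of \<open>X\<^sub>2\<close>
  the congruence with \<open>X\<close> decouples \<open>P\<close>; the damping term only acts on the second block. If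
  \<open>Ptilde(\<plusminus>i\<omega>) u = 0\<close> then \<open>X\<^sub>1 u\<close> lies in the range of \<open>X\<^sub>2\<close>, hence \<open>u = 0\<close>. A matrix \<open>W\<close> with fewer than \<open>p\<close>
  columns leaves some nonzero vector of the kernel undamped.\<close>

subsection \<open>Matrix arithmetic by dimensions\<close>

text \<open>Two obstacles shape the proof. First, \<open>mat_sqrt\<close> is a definite description,
  so nothing is known about \<open>X2\<close> or the matrix called T-hat until positive definite
  roots are shown to exist and to be unique. Second, \<open>Q1\<close> cannot serve as the
  complement: it is orthogonal to \<open>Q2\<close> in the standard inner product, whereas the
  congruence needs orthogonality with respect to \<open>M\<close>. The complement is therefore built
  by removing from \<open>Q1\<close> its \<open>M\<close>-projection onto the range of
  \<open>Q2\<close> and normalising what remains by an inverse square root. T-hat has its form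
  because \<open>Q2\<close> equals \<open>X2\<close> times the root of
  \<open>B = mat_adjoint Q2 * M * Q2\<close>: moving that root from both copies of \<open>Q2\<close>
  onto \<open>T\<close> expresses the damping matrix through \<open>X2\<close>. Full row rank of
  \<open>R\<close> enters at one point: it keeps the left null space of the factored matrix from
  being larger than the range of \<open>Q2\<close>.\<close>

text \<open>Versions of the ring laws with conditions on dimensions only, which the simplifier can
  discharge without guessing intermediate sizes.\<close>

lemma mult_assoc_dim:
  fixes A B C :: "'a :: semiring_0 mat"
  shows "dim_col A = dim_row B \<Longrightarrow> dim_col B = dim_row C \<Longrightarrow> A * B * C = A * (B * C)"
  by (rule assoc_mult_mat) auto

lemma mult_vec_assoc_dim:
  fixes A B :: "'a :: semiring_0 mat"
  shows "dim_col A = dim_row B \<Longrightarrow> dim_col B = dim_vec v \<Longrightarrow> A * B *\<^sub>v v = A *\<^sub>v (B *\<^sub>v v)"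
  by (rule assoc_mult_mat_vec) auto

lemma add_mult_dim:
  fixes A B C :: "'a :: semiring_0 mat"
  shows "dim_row A = dim_row B \<Longrightarrow> dim_col A = dim_col B \<Longrightarrow> dim_col B = dim_row C \<Longrightarrow>
    (A + B) * C = A * C + B * C"
  by (rule add_mult_distrib_mat[of _ "dim_row B" "dim_col B"]) auto

lemma mult_add_dim:
  fixes A B C :: "'a :: semiring_0 mat"
  shows "dim_row B = dim_row C \<Longrightarrow> dim_col B = dim_col C \<Longrightarrow> dim_col A = dim_row B \<Longrightarrow>
    A * (B + C) = A * B + A * C"
  by (rule mult_add_distrib_mat[of _ _ "dim_row B" _ "dim_col B"]) auto

lemma smult_mult_dim:
  fixes A B :: "'a :: comm_semiring_0 mat"
  shows "dim_col A = dim_row B \<Longrightarrow> (c \<cdot>\<^sub>m A) * B = c \<cdot>\<^sub>m (A * B)"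
  by (rule mult_smult_assoc_mat) auto

lemma mult_smult_dim:
  fixes A B :: "'a :: comm_semiring_0 mat"
  shows "dim_col A = dim_row B \<Longrightarrow> A * (c \<cdot>\<^sub>m B) = c \<cdot>\<^sub>m (A * B)"
  by (rule mult_smult_distrib) auto

lemma add_mult_vec_dim:
  fixes A B :: "'a :: semiring_0 mat"
  shows "dim_row A = dim_row B \<Longrightarrow> dim_col A = dim_col B \<Longrightarrow> dim_col B = dim_vec v \<Longrightarrow>
    (A + B) *\<^sub>v v = A *\<^sub>v v + B *\<^sub>v v"
  by (rule add_mult_distrib_mat_vec[of _ "dim_row B" "dim_col B"]) auto

lemma smult_mult_vec_dim:
  fixes A :: "'a :: comm_semiring_0 mat"
  shows "dim_col A = dim_vec v \<Longrightarrow> (c \<cdot>\<^sub>m A) *\<^sub>v v = c \<cdot>\<^sub>v (A *\<^sub>v v)"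
  by (intro eq_vecI) (auto simp: scalar_prod_def sum_distrib_left ac_simps)

lemma mult_vec_smult_dim:
  fixes A :: "'a :: comm_semiring_0 mat"
  shows "dim_col A = dim_vec v \<Longrightarrow> A *\<^sub>v (c \<cdot>\<^sub>v v) = c \<cdot>\<^sub>v (A *\<^sub>v v)"
  by (intro eq_vecI) (auto simp: scalar_prod_def sum_distrib_left ac_simps)

lemma mult_vec_add_dim:
  fixes A :: "'a :: semiring_0 mat"
  shows "dim_col A = dim_vec v \<Longrightarrow> dim_vec v = dim_vec w \<Longrightarrow> A *\<^sub>v (v + w) = A *\<^sub>v v + A *\<^sub>v w"
  by (rule mult_add_distrib_mat_vec[of _ "dim_row A" "dim_vec v"]) (auto intro: carrier_vecI)

lemma mult_minus_dim:
  fixes A B C :: "'a :: ring mat"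
  shows "dim_row B = dim_row C \<Longrightarrow> dim_col B = dim_col C \<Longrightarrow> dim_col A = dim_row B \<Longrightarrow>
    A * (B - C) = A * B - A * C"
  by (rule mult_minus_distrib_mat[of _ _ "dim_row B" _ "dim_col B"]) auto

lemma minus_mult_vec_dim:
  fixes A B :: "'a :: ring mat"
  shows "dim_row A = dim_row B \<Longrightarrow> dim_col A = dim_col B \<Longrightarrow> dim_col B = dim_vec v \<Longrightarrow>
    (A - B) *\<^sub>v v = A *\<^sub>v v - B *\<^sub>v v"
  by (rule minus_mult_distrib_mat_vec[of _ "dim_row B" "dim_col B"]) auto

lemma mult_zero_vec_dim [simp]:
  fixes A :: "'a :: semiring_0 mat"
  shows "dim_col A = m \<Longrightarrow> A *\<^sub>v 0\<^sub>v m = 0\<^sub>v (dim_row A)"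
  by (intro eq_vecI) auto

lemma zero_mult_vec_dim [simp]:
  fixes v :: "'a :: semiring_0 vec"
  shows "dim_vec v = m \<Longrightarrow> 0\<^sub>m n m *\<^sub>v v = 0\<^sub>v n"
  by (intro eq_vecI) (auto simp: scalar_prod_def)

lemma mult_zero_dim [simp]:
  fixes A :: "'a :: semiring_0 mat"
  shows "dim_col A = m \<Longrightarrow> A * 0\<^sub>m m k = 0\<^sub>m (dim_row A) k"
    "dim_row A = m \<Longrightarrow> 0\<^sub>m k m * A = 0\<^sub>m k (dim_col A)"
  by (intro eq_matI; auto)+

lemma mult_one_dim [simp]:
  fixes A :: "'a :: semiring_1 mat"
  shows "dim_col A = m \<Longrightarrow> A * 1\<^sub>m m = A" "dim_row A = m \<Longrightarrow> 1\<^sub>m m * A = A"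
  by (auto intro: right_mult_one_mat left_mult_one_mat)

lemma col_mult_dim:
  fixes A B :: "'a :: semiring_0 mat"
  shows "dim_col A = dim_row B \<Longrightarrow> j < dim_col B \<Longrightarrow> col (A * B) j = A *\<^sub>v col B j"
  by (rule col_mult2) auto

lemmas mat_dim_simps = mult_assoc_dim mult_vec_assoc_dim add_mult_dim mult_add_dim smult_mult_dim
  mult_smult_dim add_mult_vec_dim smult_mult_vec_dim mult_vec_smult_dim mult_vec_add_dim

subsection \<open>Adjoints and positive definite matrices\<close>

lemma mat_adjoint_carrier [simp]:
  "A \<in> carrier_mat n m \<Longrightarrow> mat_adjoint A \<in> carrier_mat m n"
  by (auto simp: mat_adjoint_def)

lemma dim_mat_adjoint [simp]:
  "dim_row (mat_adjoint A) = dim_col A" "dim_col (mat_adjoint A) = dim_row A"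
  by (auto simp: mat_adjoint_def)

lemma index_mat_adjoint [simp]:
  "i < dim_col A \<Longrightarrow> j < dim_row A \<Longrightarrow> mat_adjoint A $$ (i, j) = conjugate (A $$ (j, i))"
  by (simp add: mat_adjoint_def mat_of_rows_def)

lemma mat_adjoint_adjoint [simp]: "mat_adjoint (mat_adjoint A) = A"
  by (rule eq_matI) auto

lemma mat_adjoint_one [simp]: "mat_adjoint (1\<^sub>m n :: 'a :: conjugatable_ordered_field mat) = 1\<^sub>m n"
proof (rule eq_matI)
  \<comment> \<open>\<open>conjugate 1\<close> is a nonzero idempotent, since conjugation is
    multiplicative and injective.\<close>
  have "conjugate (1::'a) = 1"
    by (metis conjugate_cancel_iff conjugate_dist_mul mult_cancel_left1 conjugate_zero)
  then show "mat_adjoint (1\<^sub>m n :: 'a mat) $$ (i, j) = 1\<^sub>m n $$ (i, j)"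
    if "i < dim_row (1\<^sub>m n :: 'a mat)" "j < dim_col (1\<^sub>m n :: 'a mat)" for i j
    using that by auto
qed auto

lemma mat_adjoint_zero [simp]: "mat_adjoint (0\<^sub>m n m) = 0\<^sub>m m n"
  by (rule eq_matI) auto

lemma mat_adjoint_mult:
  assumes "dim_col A = dim_row B"
  shows "mat_adjoint (A * B) = mat_adjoint B * mat_adjoint A"
  using assms
  by (intro eq_matI) (auto simp: scalar_prod_def sum_conjugate conjugate_dist_mul mult.commute intro!: sum.cong)

lemma mat_adjoint_add:
  assumes "dim_row A = dim_row B" "dim_col A = dim_col B"
  shows "mat_adjoint (A + B) = mat_adjoint A + mat_adjoint B"
  using assms by (intro eq_matI) (auto simp: conjugate_dist_add)

lemma mat_adjoint_minus:
  fixes A B :: "'a :: conjugatable_field mat"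
  assumes "dim_row A = dim_row B" "dim_col A = dim_col B"
  shows "mat_adjoint (A - B) = mat_adjoint A - mat_adjoint B"
proof -
  have "conjugate (a - b) = conjugate a - conjugate b" for a b :: 'a
    by (metis conjugate_dist_add conjugate_neg diff_conv_add_uminus)
  then show ?thesis using assms by (intro eq_matI) auto
qed

lemma mat_adjoint_smult: "mat_adjoint (c \<cdot>\<^sub>m A) = conjugate c \<cdot>\<^sub>m mat_adjoint A"
  by (intro eq_matI) (auto simp: conjugate_dist_mul)

lemma cscalar_prod_mat_adjoint:
  assumes A: "A \<in> carrier_mat n m" and v: "v \<in> carrier_vec m" and w: "w \<in> carrier_vec n"
  shows "(A *\<^sub>v v) \<bullet>c w = v \<bullet>c (mat_adjoint A *\<^sub>v w)"
proof -
  have "(A *\<^sub>v v) \<bullet>c w = (\<Sum>i = 0..<n. \<Sum>j = 0..<m. A $$ (i, j) * v $ j * conjugate (w $ i))"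
    using assms by (simp add: scalar_prod_def sum_distrib_right)
  also have "\<dots> = (\<Sum>j = 0..<m. \<Sum>i = 0..<n. A $$ (i, j) * v $ j * conjugate (w $ i))"
    by (rule sum.swap)
  also have "\<dots> = v \<bullet>c (mat_adjoint A *\<^sub>v w)"
    using assms
    by (auto simp: scalar_prod_def sum_distrib_left sum_conjugate conjugate_dist_mul ac_simps intro!: sum.cong)
  finally show ?thesis .
qed

lemma cscalar_prod_add_left:
  "u \<in> carrier_vec n \<Longrightarrow> v \<in> carrier_vec n \<Longrightarrow> w \<in> carrier_vec n \<Longrightarrow> (u + v) \<bullet>c w = u \<bullet>c w + v \<bullet>c w"
  by (simp add: add_scalar_prod_distrib[of _ n])

lemma cscalar_prod_self_real:
  fixes v :: "complex vec"
  assumes "v \<in> carrier_vec n" "v \<noteq> 0\<^sub>v n"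
  shows "0 < Re (v \<bullet>c v)" "Im (v \<bullet>c v) = 0"
  using conjugate_square_greater_0_vec[OF assms(1)] assms(2) by (auto simp: less_complex_def)

lemma pos_defD:
  assumes "pos_def n A"
  shows "A \<in> carrier_mat n n" "mat_adjoint A = A"
    "\<And>v. v \<in> carrier_vec n \<Longrightarrow> v \<noteq> 0\<^sub>v n \<Longrightarrow> 0 < (A *\<^sub>v v) \<bullet>c v"
  using assms by (auto simp: pos_def_def)

lemma pos_semidefD:
  assumes "pos_semidef n A"
  shows "A \<in> carrier_mat n n" "mat_adjoint A = A"
    "\<And>v. v \<in> carrier_vec n \<Longrightarrow> 0 \<le> (A *\<^sub>v v) \<bullet>c v"
  using assms by (auto simp: pos_semidef_def)

text \<open>The form of the product at \<open>v\<close> is the form of \<open>A\<close> at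
  \<open>X *\<^sub>v v\<close>, which injectivity keeps away from zero. \<open>X\<close> may be
  rectangular, so this covers compressions to a subspace as well as changes of basis.\<close>

lemma pos_def_congruence:
  assumes A: "pos_def n A" and X: "X \<in> carrier_mat n k"
    and inj: "\<And>v. v \<in> carrier_vec k \<Longrightarrow> X *\<^sub>v v = 0\<^sub>v n \<Longrightarrow> v = 0\<^sub>v k"
  shows "pos_def k (mat_adjoint X * A * X)"
  unfolding pos_def_def
proof (intro conjI ballI impI)
  note A' = pos_defD[OF A]
  note [simp] = carrier_matD[OF A'(1)] carrier_matD[OF X]
  show "mat_adjoint X * A * X \<in> carrier_mat k k" by (rule carrier_matI) simp_all
  show "mat_adjoint (mat_adjoint X * A * X) = mat_adjoint X * A * X"
    by (simp add: mat_adjoint_mult A'(2) mat_dim_simps)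
  fix v :: "complex vec" assume v: "v \<in> carrier_vec k" "v \<noteq> 0\<^sub>v k"
  have "(mat_adjoint X * A * X) *\<^sub>v v = mat_adjoint X *\<^sub>v (A *\<^sub>v (X *\<^sub>v v))"
    using v by (simp add: mat_dim_simps)
  then have "((mat_adjoint X * A * X) *\<^sub>v v) \<bullet>c v = (A *\<^sub>v (X *\<^sub>v v)) \<bullet>c (X *\<^sub>v v)"
    using A'(1) X v by (simp add: cscalar_prod_mat_adjoint[of _ k n])
  also have "0 < \<dots>" using A'(3)[of "X *\<^sub>v v"] inj[of v] v X by auto
  finally show "0 < ((mat_adjoint X * A * X) *\<^sub>v v) \<bullet>c v" .
qed

lemma pos_def_inj:
  assumes A: "pos_def n A" and v: "v \<in> carrier_vec n" "A *\<^sub>v v = 0\<^sub>v n"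
  shows "v = 0\<^sub>v n"
  using pos_defD(3)[OF A, of v] v by (cases "v = 0\<^sub>v n") auto

lemma pos_def_det: "pos_def n A \<Longrightarrow> det A \<noteq> 0"
  using pos_def_inj[of n A] pos_defD(1)[of n A] by (auto simp: det_0_iff_vec_prod_zero)

text \<open>\<open>mat_inv_sqrt\<close> strips an option. A nonzero determinant makes
  \<open>A\<close> a unit of the matrix ring, which rules out \<open>None\<close>.\<close>

lemma mat_inverse_det:
  fixes A :: "'a :: field mat"
  assumes A: "A \<in> carrier_mat n n" and d: "det A \<noteq> 0"
  shows "the (mat_inverse A) \<in> carrier_mat n n" "A * the (mat_inverse A) = 1\<^sub>m n"
    "the (mat_inverse A) * A = 1\<^sub>m n"
proof -
  have "A \<in> Units (ring_mat TYPE('a) n n)"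
    using det_non_zero_imp_unit[OF A d] .
  with mat_inverse(1)[OF A, where b = n] obtain B where "mat_inverse A = Some B" by (cases "mat_inverse A") auto
  with mat_inverse(2)[OF A this]
  show "the (mat_inverse A) \<in> carrier_mat n n" "A * the (mat_inverse A) = 1\<^sub>m n"
    "the (mat_inverse A) * A = 1\<^sub>m n" by auto
qed


section \<open>Uniqueness of positive definite square roots\<close>

lemma pos_def_add:
  assumes "pos_def n A" "pos_def n B"
  shows "pos_def n (A + B)"
proof -
  note A = pos_defD[OF assms(1)] and B = pos_defD[OF assms(2)]
  note [simp] = carrier_matD[OF A(1)] carrier_matD[OF B(1)]
  have "0 < ((A + B) *\<^sub>v v) \<bullet>c v" if v: "v \<in> carrier_vec n" "v \<noteq> 0\<^sub>v n" for v
    using A(1) B(1) A(3)[OF v] B(3)[OF v] v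
    by (simp add: mat_dim_simps cscalar_prod_add_left[of _ n] add_pos_pos)
  then show ?thesis
    using A(1) B(1) by (auto simp: pos_def_def mat_adjoint_add A(2) B(2))
qed

text \<open>The trace is spelled out as a diagonal sum. Its cyclicity later moves \<open>T\<close>
  from the outside of \<open>E * (E * T)\<close> to between the two copies of
  \<open>E\<close>.\<close>

lemma trace_mult_swap:
  fixes A B :: "'a :: comm_semiring_0 mat"
  assumes "A \<in> carrier_mat n m" "B \<in> carrier_mat m n"
  shows "(\<Sum>i<n. (A * B) $$ (i, i)) = (\<Sum>i<m. (B * A) $$ (i, i))"
proof -
  have "(\<Sum>i<n. (A * B) $$ (i, i)) = (\<Sum>i<n. \<Sum>j<m. A $$ (i, j) * B $$ (j, i))"
    using assms by (intro sum.cong) (auto simp: scalar_prod_def atLeast0LessThan)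
  also have "\<dots> = (\<Sum>j<m. \<Sum>i<n. A $$ (i, j) * B $$ (j, i))"
    by (rule sum.swap)
  also have "\<dots> = (\<Sum>i<m. (B * A) $$ (i, i))"
    using assms by (intro sum.cong) (auto simp: scalar_prod_def atLeast0LessThan mult.commute)
  finally show ?thesis .
qed

text \<open>If \<open>S\<^sup>2 = T\<^sup>2\<close> then \<open>E = S - T\<close> solves the Sylvester equation \<open>S E + E T = 0\<close>. Multiplying by
  \<open>E\<close> and taking traces makes the sum of the positive forms \<open>e\<^sup>* (S + T) e\<close> over the columns \<open>e\<close> of
  \<open>E\<close> vanish.\<close>

lemma pos_def_sqrt_unique:
  assumes S: "pos_def n S" and T: "pos_def n T" and eq: "S * S = T * T"
  shows "S = T"
proof -
  note S' = pos_defD[OF S] and T' = pos_defD[OF T]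
  note [simp] = carrier_matD[OF S'(1)] carrier_matD[OF T'(1)]
  define E where "E = S - T"
  have E: "E \<in> carrier_mat n n" by (rule carrier_matI) (simp_all add: E_def)
  have Eadj: "mat_adjoint E = E" by (simp add: E_def mat_adjoint_minus S'(2) T'(2))
  note [simp] = carrier_matD[OF E]
  have SE: "S * E + E * T = 0\<^sub>m n n"
  proof -
    have "S * E = S * S - S * T" "E * T = S * T - T * T"
      unfolding E_def using S'(1) T'(1)
      by (auto simp: mult_minus_distrib_mat[of _ n n _ n] minus_mult_distrib_mat[of _ n n _ _ n])
    \<comment> \<open>With \<open>S * S\<close> replaced by \<open>T * T\<close>, the two products
      telescope.\<close>
    moreover have "(T * T - S * T) + (S * T - T * T) = 0\<^sub>m n n"
      by (intro eq_matI) (simp_all del: index_mult_mat(1))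
    ultimately show ?thesis by (simp only: eq)
  qed
  have "E * (S * E) + E * (E * T) = E * (S * E + E * T)"
    by (simp add: mat_dim_simps)
  also have "\<dots> = 0\<^sub>m n n" by (simp add: SE)
  finally have 0: "E * (S * E) + E * (E * T) = 0\<^sub>m n n" .
  have "(\<Sum>i<n. (E * (S * E)) $$ (i, i)) + (\<Sum>i<n. (E * (E * T)) $$ (i, i))
      = (\<Sum>i<n. (E * (S * E) + E * (E * T)) $$ (i, i))"
    by (simp add: sum.distrib del: index_mult_mat(1))
  also have "\<dots> = 0" unfolding 0 by simp
  also have "(\<Sum>i<n. (E * (E * T)) $$ (i, i)) = (\<Sum>i<n. (E * (T * E)) $$ (i, i))"
    using trace_mult_swap[of E n n "E * T"] E T'(1) by (simp add: mat_dim_simps)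
  finally have "0 = (\<Sum>i<n. (E * (S * E)) $$ (i, i) + (E * (T * E)) $$ (i, i))"
    by (simp only: sum.distrib)
  also have "\<dots> = (\<Sum>i<n. ((S + T) *\<^sub>v col E i) \<bullet>c col E i)"
  proof (rule sum.cong)
    fix i assume "i \<in> {..<n}" then have i: "i < n" by simp
    have "(E * (S * E)) $$ (i, i) + (E * (T * E)) $$ (i, i) = (E * ((S + T) * E)) $$ (i, i)"
      using i by (simp add: mat_dim_simps del: index_mult_mat(1))
    also have "\<dots> = row E i \<bullet> ((S + T) *\<^sub>v col E i)"
      using i by (simp add: col_mult_dim)
    \<comment> \<open>\<open>E\<close> is Hermitian, so its rows are its conjugated columns, and a
      diagonal entry becomes a value of the form of \<open>S + T\<close>.\<close>
    also have "row E i = conjugate (col E i)"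
    proof (rule eq_vecI)
      fix j assume "j < dim_vec (conjugate (col E i))"
      then have j: "j < n" by simp
      have "E $$ (i, j) = mat_adjoint E $$ (i, j)" by (simp add: Eadj)
      then show "row E i $ j = conjugate (col E i) $ j" using i j by simp
    qed simp
    finally show "(E * (S * E)) $$ (i, i) + (E * (T * E)) $$ (i, i) = ((S + T) *\<^sub>v col E i) \<bullet>c col E i"
      by (simp add: comm_scalar_prod[of "conjugate (col E i)" n] carrier_vecI)
  qed simp
  finally have sum0: "(\<Sum>i<n. ((S + T) *\<^sub>v col E i) \<bullet>c col E i) = 0" by simp
  have col0: "col E i = 0\<^sub>v n" if i: "i < n" for i
  proof -
    note ST = pos_def_add[OF S T]
    have [simp]: "col E j \<in> carrier_vec n" for j by (rule carrier_vecI) simp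
    \<comment> \<open>The summands are nonnegative, so a vanishing sum makes each of them vanish;
      definiteness of \<open>S + T\<close> then forces each column of \<open>E\<close> to be
      zero.\<close>
    have nonneg: "0 \<le> ((S + T) *\<^sub>v col E j) \<bullet>c col E j" for j
      using pos_defD(3)[OF ST, of "col E j"] by (cases "col E j = 0\<^sub>v n") (auto simp: less_imp_le)
    have "((S + T) *\<^sub>v col E i) \<bullet>c col E i = 0"
      using sum0 nonneg i by (subst (asm) sum_nonneg_eq_0_iff) auto
    then show ?thesis using pos_defD(3)[OF ST, of "col E i"] by (cases "col E i = 0\<^sub>v n") auto
  qed
  have "S $$ (i, j) = T $$ (i, j)" if "i < n" "j < n" for i j
  proof -
    have "E $$ (i, j) = col E j $ i" using that by simp
    also have "\<dots> = 0" using col0[OF that(2)] that by simp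
    finally show ?thesis using that by (simp add: E_def)
  qed
  then show ?thesis by (intro eq_matI) auto
qed


subsection \<open>Square roots of positive definite matrices\<close>

text \<open>Complete \<open>v\<close> to a basis and orthogonalise. Gram-Schmidt leaves the first
  vector unchanged, so only the normalising factor \<open>c\<close> separates it from the first
  column.\<close>

lemma unitary_with_first_column:
  fixes v :: "complex vec"
  assumes v: "v \<in> carrier_vec n" "v \<noteq> 0\<^sub>v n"
  obtains U c where "unitary_mat n U" "col U 0 = c \<cdot>\<^sub>v v"
proof -
  interpret cof_vec_space n "TYPE(complex)" .
  note b = basis_completion[OF v]
  define ws where "ws = gram_schmidt n (basis_completion v)"
  note gs = gram_schmidt_result[OF b(2,4,5) ws_def]
  have len: "length ws = n" using gs b(6) by simp
  have ws_c: "ws ! i \<in> carrier_vec n" if "i < n" for i using gs len that by auto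
  have ne: "0 < n" using v by (cases n) auto
  have ws0: "ws ! 0 = v"
  proof -
    obtain xs where bc: "basis_completion v = v # xs"
      using b(6,7) ne by (cases "basis_completion v") auto
    then have "hd ws = v" unfolding ws_def using v by simp
    then show ?thesis using len ne by (metis hd_conv_nth length_greater_0_conv)
  qed
  \<comment> \<open>The orthogonalised vectors are not yet of length one; \<open>d i\<close> is the
    reciprocal of the norm.\<close>
  define d where "d i = complex_of_real (1 / sqrt (Re (ws ! i \<bullet>c ws ! i)))" for i
  define us where "us = map (\<lambda>i. d i \<cdot>\<^sub>v ws ! i) [0..<n]"
  define U where "U = mat_of_cols n us"
  have U: "U \<in> carrier_mat n n" by (simp add: U_def us_def mat_of_cols_def)
  have colU: "col U i = d i \<cdot>\<^sub>v ws ! i" if "i < n" for i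
    using that ws_c[OF that] by (simp add: U_def us_def)
  have "mat_adjoint U * U = 1\<^sub>m n"
  proof (rule eq_matI)
    fix i j assume "i < dim_row (1\<^sub>m n :: complex mat)" "j < dim_col (1\<^sub>m n :: complex mat)"
    then have ij: "i < n" "j < n" by auto
    have "row (mat_adjoint U) i = conjugate (col U i)"
      using ij U by (intro eq_vecI) auto
    then have "(mat_adjoint U * U) $$ (i, j) = col U j \<bullet>c col U i"
      using ij U by (simp add: comm_scalar_prod[of _ n])
    also have "\<dots> = d j * cnj (d i) * (ws ! j \<bullet>c ws ! i)"
      using ws_c ij by (simp add: colU conjugate_smult_vec smult_scalar_prod_distrib[of _ n] scalar_prod_smult_distrib[of _ n])
    also have "\<dots> = 1\<^sub>m n $$ (i, j)"
    proof (cases "i = j")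
      case True
      define r where "r = ws ! i \<bullet>c ws ! i"
      have "r \<noteq> 0" using corthogonalD[OF gs(2), of i i] ij len by (simp add: r_def)
      moreover have "0 \<le> r" using conjugate_square_ge_0_vec by (simp add: r_def)
      ultimately have "0 < Re r" "Im r = 0"
        by (auto simp: less_eq_complex_def complex_eq_iff)
      then have "d i * cnj (d i) * r = 1"
        by (simp add: d_def r_def[symmetric] complex_eq_iff)
      then show ?thesis using True ij by (simp add: r_def)
    next
      case False
      then show ?thesis using corthogonalD[OF gs(2), of j i] ij len by simp
    qed
    finally show "(mat_adjoint U * U) $$ (i, j) = 1\<^sub>m n $$ (i, j)" .
  qed (use U in auto)
  then have "unitary_mat n U" using U by (simp add: unitary_mat_def)
  moreover have "col U 0 = d 0 \<cdot>\<^sub>v v" using colU[OF ne] ws0 by simp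
  ultimately show ?thesis by (rule that)
qed

lemma unitary_matD:
  assumes "unitary_mat n U"
  shows "U \<in> carrier_mat n n" "mat_adjoint U * U = 1\<^sub>m n" "U * mat_adjoint U = 1\<^sub>m n"
  using assms mat_mult_left_right_inverse[of "mat_adjoint U" n U] by (auto simp: unitary_mat_def)

lemma cscalar_prod_append:
  assumes "a \<in> carrier_vec n" "c \<in> carrier_vec n" "b \<in> carrier_vec m" "d \<in> carrier_vec m"
  shows "(a @\<^sub>v b) \<bullet>c (c @\<^sub>v d) = a \<bullet>c c + b \<bullet>c d"
proof -
  have "conjugate (c @\<^sub>v d) = conjugate c @\<^sub>v conjugate d"
    by (intro eq_vecI) auto
  then show ?thesis using assms by (simp add: scalar_prod_append[of _ n _ m])
qed

text \<open>The two-block case of \<open>diag_block_mat\<close> as one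
  \<open>four_block_mat\<close>, to which the block rules for products, adjoints and determinants
  apply directly.\<close>

definition diag2 :: "'a :: zero mat \<Rightarrow> 'a mat \<Rightarrow> 'a mat" where
  "diag2 A B = four_block_mat A (0\<^sub>m (dim_row A) (dim_col B)) (0\<^sub>m (dim_row B) (dim_col A)) B"

lemma diag_block_mat_pair: "diag_block_mat [A, B] = diag2 A B"
  by (subst diag_block_mat.simps) (simp only: diag_block_mat_singleton diag2_def Let_def)

lemma diag2_mult_vec:
  fixes A B :: "'a :: comm_ring_1 mat"
  assumes "A \<in> carrier_mat n n" "B \<in> carrier_mat m m" "a \<in> carrier_vec n" "b \<in> carrier_vec m"
  shows "diag2 A B *\<^sub>v (a @\<^sub>v b) = (A *\<^sub>v a) @\<^sub>v (B *\<^sub>v b)"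
  using assms by (simp add: diag2_def mult_mat_vec_split)

lemma diag2_carrier [simp]:
  "A \<in> carrier_mat n n \<Longrightarrow> B \<in> carrier_mat m m \<Longrightarrow> diag2 A B \<in> carrier_mat (n + m) (n + m)"
  by (simp add: diag2_def)

lemma mat_adjoint_four_block:
  assumes "A \<in> carrier_mat nr1 nc1" "B \<in> carrier_mat nr1 nc2"
    "C \<in> carrier_mat nr2 nc1" "D \<in> carrier_mat nr2 nc2"
  shows "mat_adjoint (four_block_mat A B C D)
    = four_block_mat (mat_adjoint A) (mat_adjoint C) (mat_adjoint B) (mat_adjoint D)"
  using assms by (intro eq_matI) auto

lemma pos_def_diag2:
  assumes A: "pos_def n A" and B: "pos_def m B"
  shows "pos_def (n + m) (diag2 A B)"
  unfolding pos_def_def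
proof (intro conjI ballI impI)
  note A' = pos_defD[OF A] and B' = pos_defD[OF B]
  show "diag2 A B \<in> carrier_mat (n + m) (n + m)" using A'(1) B'(1) by simp
  show "mat_adjoint (diag2 A B) = diag2 A B"
    unfolding diag2_def using A'(1,2) B'(1,2) by (simp add: mat_adjoint_four_block[of _ n n _ m _ m])
  fix v :: "complex vec" assume v: "v \<in> carrier_vec (n + m)" "v \<noteq> 0\<^sub>v (n + m)"
  define a b where "a = vec_first v n" and "b = vec_last v m"
  have ab: "a \<in> carrier_vec n" "b \<in> carrier_vec m" and v_ab: "v = a @\<^sub>v b"
    using v by (auto simp: a_def b_def)
  have "a \<noteq> 0\<^sub>v n \<or> b \<noteq> 0\<^sub>v m"
    using v(2) by (auto simp: v_ab)
  moreover have "0 \<le> (A *\<^sub>v a) \<bullet>c a"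
    using A'(3)[OF ab(1)] A'(1) by (cases "a = 0\<^sub>v n") (auto simp: less_imp_le)
  moreover have "0 \<le> (B *\<^sub>v b) \<bullet>c b"
    using B'(3)[OF ab(2)] B'(1) by (cases "b = 0\<^sub>v m") (auto simp: less_imp_le)
  ultimately have "0 < (A *\<^sub>v a) \<bullet>c a + (B *\<^sub>v b) \<bullet>c b"
    using A'(3)[OF ab(1)] B'(3)[OF ab(2)] by (auto intro: add_pos_nonneg add_nonneg_pos)
  then show "0 < (diag2 A B *\<^sub>v v) \<bullet>c v"
    unfolding v_ab using ab A'(1) B'(1) by (simp add: diag2_mult_vec cscalar_prod_append[of _ n _ _ m])
qed

text \<open>Vectors padded with zeros test one block at a time.\<close>

lemma pos_def_diag2D:
  assumes A: "A \<in> carrier_mat n n" and B: "B \<in> carrier_mat m m" and AB: "pos_def (n + m) (diag2 A B)"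
  shows "pos_def n A" "pos_def m B"
proof -
  note AB' = pos_defD[OF AB]
  have eq: "four_block_mat (mat_adjoint A) (0\<^sub>m n m) (0\<^sub>m m n) (mat_adjoint B)
      = four_block_mat A (0\<^sub>m n m) (0\<^sub>m m n) B"
    using AB'(2) A B unfolding diag2_def by (simp add: mat_adjoint_four_block[of _ n n _ m _ m])
  have adjA: "mat_adjoint A = A"
  proof (rule eq_matI)
    fix i j assume "i < dim_row A" "j < dim_col A"
    then show "mat_adjoint A $$ (i, j) = A $$ (i, j)"
      using arg_cong[OF eq, of "\<lambda>X. X $$ (i, j)"] A B by simp
  qed (use A in auto)
  have adjB: "mat_adjoint B = B"
  proof (rule eq_matI)
    fix i j assume "i < dim_row B" "j < dim_col B"
    then show "mat_adjoint B $$ (i, j) = B $$ (i, j)"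
      using arg_cong[OF eq, of "\<lambda>X. X $$ (n + i, n + j)"] A B by simp
  qed (use B in auto)
  have "0 < (A *\<^sub>v a) \<bullet>c a" if a: "a \<in> carrier_vec n" "a \<noteq> 0\<^sub>v n" for a
  proof -
    have "a @\<^sub>v 0\<^sub>v m \<noteq> 0\<^sub>v (n + m)"
    proof
      assume "a @\<^sub>v 0\<^sub>v m = 0\<^sub>v (n + m)"
      then have "a @\<^sub>v 0\<^sub>v m = 0\<^sub>v n @\<^sub>v (0\<^sub>v m :: complex vec)" by auto
      then show False using a by (simp add: append_vec_eq[of _ n])
    qed
    then show ?thesis using AB'(3)[of "a @\<^sub>v 0\<^sub>v m"] a A B
      by (simp add: diag2_mult_vec cscalar_prod_append[of _ n _ _ m])
  qed
  then show "pos_def n A" using A adjA by (simp add: pos_def_def)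
  have "0 < (B *\<^sub>v b) \<bullet>c b" if b: "b \<in> carrier_vec m" "b \<noteq> 0\<^sub>v m" for b
  proof -
    have "0\<^sub>v n @\<^sub>v b \<noteq> 0\<^sub>v (n + m)"
    proof
      assume "0\<^sub>v n @\<^sub>v b = 0\<^sub>v (n + m)"
      then have "0\<^sub>v n @\<^sub>v b = 0\<^sub>v n @\<^sub>v (0\<^sub>v m :: complex vec)" by auto
      then show False using b by (simp add: append_vec_eq[of _ n])
    qed
    then show ?thesis using AB'(3)[of "0\<^sub>v n @\<^sub>v b"] b A B
      by (simp add: diag2_mult_vec cscalar_prod_append[of _ n _ _ m])
  qed
  then show "pos_def m B" using B adjB by (simp add: pos_def_def)
qed


text \<open>Deflation: a unitary change of basis that begins with an eigenvector splits off a 1 by 1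
  block. The roots of the two blocks are assembled and transported back.\<close>

lemma pos_def_sqrt_exists:
  "pos_def n B \<Longrightarrow> \<exists>S. pos_def n S \<and> S * S = B"
proof (induction n arbitrary: B)
  case 0
  \<comment> \<open>A matrix of size 0 is its own square root.\<close>
  have "pos_def 0 B" using 0 .
  moreover have "B * B = B" using pos_defD(1)[OF 0] by (intro eq_matI) auto
  ultimately show ?case by blast
next
  case (Suc n)
  note B = pos_defD[OF Suc.prems]
  obtain e v where ev: "v \<in> carrier_vec (Suc n)" "v \<noteq> 0\<^sub>v (Suc n)" "B *\<^sub>v v = e \<cdot>\<^sub>v v"
    using spectrum_non_empty[OF B(1)] B(1)
    by (auto simp: spectrum_def eigenvalue_def eigenvector_def)
  obtain U c where U: "unitary_mat (Suc n) U" and U0: "col U 0 = c \<cdot>\<^sub>v v"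
    using unitary_with_first_column[OF ev(1,2)] .
  note U' = unitary_matD[OF U]
  note [simp] = carrier_matD[OF B(1)] carrier_matD[OF U'(1)]
  define A where "A = mat_adjoint U * B * U"
  have A_pd: "pos_def (Suc n) A"
    unfolding A_def
  proof (rule pos_def_congruence[OF Suc.prems U'(1)])
    fix w assume w: "w \<in> carrier_vec (Suc n)" "U *\<^sub>v w = 0\<^sub>v (Suc n)"
    have "w = mat_adjoint U *\<^sub>v (U *\<^sub>v w)"
      using w(1) U'(2) by (simp flip: mult_vec_assoc_dim)
    then show "w = 0\<^sub>v (Suc n)" using w by simp
  qed
  note A = pos_defD[OF A_pd]
  note [simp] = carrier_matD[OF A(1)]
  have colA: "col A 0 = e \<cdot>\<^sub>v unit_vec (Suc n) 0"
  proof -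
    have "col A 0 = mat_adjoint U *\<^sub>v (B *\<^sub>v col U 0)"
      by (simp add: A_def mult_assoc_dim col_mult_dim)
    also have "B *\<^sub>v col U 0 = e \<cdot>\<^sub>v col U 0"
      using ev by (simp add: U0 mult_vec_smult_dim smult_smult_assoc mult.commute)
    also have "mat_adjoint U *\<^sub>v (e \<cdot>\<^sub>v col U 0) = e \<cdot>\<^sub>v col (mat_adjoint U * U) 0"
      by (simp add: mult_vec_smult_dim col_mult_dim)
    finally show ?thesis by (simp add: U'(2))
  qed
  have Ai0: "A $$ (i, 0) = (if i = 0 then e else 0)" if "i < Suc n" for i
    using that arg_cong[OF colA, of "\<lambda>w. w $ i"] by simp
  \<comment> \<open>The first column is zero below the corner because it comes from an eigenvector;
    the first row is zero because \<open>A\<close> is Hermitian.\<close>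
  have A0i: "A $$ (0, i) = 0" if "i < Suc n" "i \<noteq> 0" for i
  proof -
    have "A $$ (0, i) = mat_adjoint A $$ (0, i)" by (simp add: A(2))
    also have "\<dots> = 0" using Ai0[of i] that by simp
    finally show ?thesis .
  qed
  define A1 A4 where "A1 = mat 1 1 (\<lambda>_. e)" and "A4 = mat n n (\<lambda>(i, j). A $$ (i + 1, j + 1))"
  have A_diag: "A = diag2 A1 A4"
    using Ai0 A0i by (intro eq_matI) (auto simp: diag2_def A1_def A4_def)
  have c14: "A1 \<in> carrier_mat 1 1" "A4 \<in> carrier_mat n n" by (auto simp: A1_def A4_def)
  have pd14: "pos_def 1 A1" "pos_def n A4"
    using pos_def_diag2D[OF c14] A_pd A_diag by auto
  obtain S4 where S4: "pos_def n S4" "S4 * S4 = A4" using Suc.IH[OF pd14(2)] by blast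
  have "0 < e"
  proof -
    have "(A1 *\<^sub>v unit_vec 1 0) \<bullet>c unit_vec 1 0 = e"
      by (simp add: A1_def scalar_prod_def)
    then show ?thesis using pos_defD(3)[OF pd14(1), of "unit_vec 1 0"]
      by (metis (full_types) index_unit_vec(1) index_zero_vec(1) less_one unit_vec_carrier zero_neq_one)
  qed
  \<comment> \<open>The eigenvalue is the entry of a positive definite 1 by 1 block, hence a
    positive real, and \<open>Re e\<close> loses nothing.\<close>
  define r where "r = complex_of_real (sqrt (Re e))"
  have r: "0 < r" "r * r = e" "cnj r = r"
    using \<open>0 < e\<close> by (auto simp: r_def less_complex_def complex_eq_iff)
  define S1 where "S1 = mat 1 1 (\<lambda>_. r)"
  have S1: "pos_def 1 S1"
    unfolding pos_def_def
  proof (intro conjI ballI impI)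
    show "S1 \<in> carrier_mat 1 1" by (simp add: S1_def)
    show "mat_adjoint S1 = S1" using r(3) by (intro eq_matI) (auto simp: S1_def)
    fix w :: "complex vec" assume w: "w \<in> carrier_vec 1" "w \<noteq> 0\<^sub>v 1"
    then have "w $ 0 \<noteq> 0" by auto
    then have "0 < w $ 0 * conjugate (w $ 0)"
      by (simp only: conjugate_square_greater_0 not_False_eq_True)
    then have "0 < r * (w $ 0 * conjugate (w $ 0))"
      using r(1) by (simp add: less_complex_def)
    then show "0 < (S1 *\<^sub>v w) \<bullet>c w" using w by (simp add: S1_def scalar_prod_def mult.assoc)
  qed
  have S1S1: "S1 * S1 = A1"
    using r(2) by (intro eq_matI) (auto simp: S1_def A1_def scalar_prod_def)
  define S where "S = diag2 S1 S4"
  have S_pd: "pos_def (Suc n) S" using pos_def_diag2[OF S1 S4(1)] by (simp add: S_def)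
  note cS = pos_defD(1)[OF S1] pos_defD(1)[OF S4(1)]
  have "S * S = A"
    unfolding S_def A_diag diag2_def
    using cS c14 S1S1 S4(2) by (simp add: mult_four_block_mat[of _ 1 1 _ n _ n _ _ 1 _ n])
  note [simp] = carrier_matD[OF pos_defD(1)[OF S_pd]]
  define R where "R = U * S * mat_adjoint U"
  have "pos_def (Suc n) R"
  proof -
    have "pos_def (Suc n) (mat_adjoint (mat_adjoint U) * S * mat_adjoint U)"
    proof (rule pos_def_congruence[OF S_pd])
      show "mat_adjoint U \<in> carrier_mat (Suc n) (Suc n)" using U'(1) by simp
      fix w assume w: "w \<in> carrier_vec (Suc n)" "mat_adjoint U *\<^sub>v w = 0\<^sub>v (Suc n)"
      have "w = U *\<^sub>v (mat_adjoint U *\<^sub>v w)"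
        using w(1) U'(3) by (simp flip: mult_vec_assoc_dim)
      then show "w = 0\<^sub>v (Suc n)" using w by simp
    qed
    then show ?thesis by (simp add: R_def)
  qed
  moreover have "R * R = B"
  proof -
    have "R * R = U * (S * ((mat_adjoint U * U) * (S * mat_adjoint U)))"
      by (simp add: R_def mult_assoc_dim)
    also have "\<dots> = U * ((S * S) * mat_adjoint U)"
      by (simp add: U'(2) mult_assoc_dim)
    also have "\<dots> = (U * mat_adjoint U) * B * (U * mat_adjoint U)"
      by (simp add: \<open>S * S = A\<close> A_def mult_assoc_dim)
    finally show ?thesis by (simp add: U'(3))
  qed
  ultimately show ?case by blast
qed

text \<open>Existence and uniqueness together discharge the definite description.\<close>

lemma mat_sqrt:
  assumes "pos_def n B"
  shows "pos_def n (mat_sqrt B)" "mat_sqrt B * mat_sqrt B = B"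
proof -
  have "\<exists>!S. pos_def n S \<and> S * S = B"
    using pos_def_sqrt_exists[OF assms] pos_def_sqrt_unique[of n] by (metis (no_types))
  from theI'[OF this] show "pos_def n (mat_sqrt B)" "mat_sqrt B * mat_sqrt B = B"
    using pos_defD(1)[OF assms] by (auto simp: mat_sqrt_def)
qed

lemma mat_inv_sqrt:
  assumes B: "pos_def n B"
  shows "mat_inv_sqrt B \<in> carrier_mat n n" "mat_adjoint (mat_inv_sqrt B) = mat_inv_sqrt B"
    "mat_sqrt B * mat_inv_sqrt B = 1\<^sub>m n" "mat_inv_sqrt B * mat_sqrt B = 1\<^sub>m n"
    "mat_inv_sqrt B * B * mat_inv_sqrt B = 1\<^sub>m n"
    "mat_inv_sqrt B * B = mat_sqrt B" "B * mat_inv_sqrt B = mat_sqrt B"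
proof -
  define S S' where "S = mat_sqrt B" and "S' = mat_inv_sqrt B"
  note S = mat_sqrt[OF B, folded S_def]
  note S1 = pos_defD[OF S(1)]
  have S': "S' \<in> carrier_mat n n" "S * S' = 1\<^sub>m n" "S' * S = 1\<^sub>m n"
    using mat_inverse_det[OF S1(1) pos_def_det[OF S(1)]]
    by (auto simp: S'_def S_def mat_inv_sqrt_def)
  note [simp] = carrier_matD[OF S1(1)] carrier_matD[OF S'(1)]
  \<comment> \<open>As \<open>S\<close> is Hermitian, the adjoint of its right inverse is a left
    inverse, and the two must agree.\<close>
  have "mat_adjoint S' = mat_adjoint S' * (S * S')" by (simp add: S'(2))
  also have "\<dots> = mat_adjoint (S * S') * S'"
    by (simp add: mat_adjoint_mult S1(2) mult_assoc_dim del: mult_one_dim)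
  also have "\<dots> = S'" by (simp add: S'(2))
  finally have adj: "mat_adjoint S' = S'" .
  have SB: "S' * B = S" and BS: "B * S' = S"
    by (simp_all add: S(2)[symmetric] S'(2) mult_assoc_dim) (simp flip: mult_assoc_dim add: S'(3))
  show "mat_inv_sqrt B \<in> carrier_mat n n" "mat_adjoint (mat_inv_sqrt B) = mat_inv_sqrt B"
    "mat_sqrt B * mat_inv_sqrt B = 1\<^sub>m n" "mat_inv_sqrt B * mat_sqrt B = 1\<^sub>m n"
    "mat_inv_sqrt B * B * mat_inv_sqrt B = 1\<^sub>m n"
    "mat_inv_sqrt B * B = mat_sqrt B" "B * mat_inv_sqrt B = mat_sqrt B"
    using S' adj SB BS by (simp_all add: S_def S'_def)
qed


subsection \<open>Undamped kernels\<close>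

lemma smult_zero_vec_dim: "(c :: 'a :: mult_zero) \<cdot>\<^sub>v 0\<^sub>v n = 0\<^sub>v n"
  by (intro eq_vecI) auto

text \<open>Along the line \<open>v + s w\<close> with \<open>w = D v\<close>, the form is a
  quadratic in real \<open>s\<close> with no constant term and linear coefficient twice the squared
  norm of \<open>w\<close>. It cannot stay nonnegative for small negative \<open>s\<close> unless
  that norm is zero.\<close>

lemma pos_semidef_form_zero:
  assumes D: "pos_semidef n D" and v: "v \<in> carrier_vec n" and 0: "(D *\<^sub>v v) \<bullet>c v = 0"
  shows "D *\<^sub>v v = 0\<^sub>v n"
proof -
  note D' = pos_semidefD[OF D]
  note [simp] = carrier_matD[OF D'(1)]
  define w where "w = D *\<^sub>v v"
  have w: "w \<in> carrier_vec n" using v D'(1) by (simp add: w_def)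
  define N c where "N = Re (w \<bullet>c w)" and "c = Re ((D *\<^sub>v w) \<bullet>c w)"
  have c: "0 \<le> c" using D'(3)[OF w] by (simp add: c_def less_eq_complex_def)
  have Dwv: "(D *\<^sub>v w) \<bullet>c v = w \<bullet>c w"
    using cscalar_prod_mat_adjoint[OF D'(1) w v] by (simp add: D'(2) w_def)
  have ineq: "0 \<le> 2 * s * N + s\<^sup>2 * c" for s :: real
  proof -
    let ?s = "complex_of_real s"
    have "(D *\<^sub>v (v + ?s \<cdot>\<^sub>v w)) \<bullet>c (v + ?s \<cdot>\<^sub>v w)
        = (D *\<^sub>v v) \<bullet>c v + ?s * (w \<bullet>c w) + ?s * ((D *\<^sub>v w) \<bullet>c v) + ?s * ?s * ((D *\<^sub>v w) \<bullet>c w)"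
    proof -
      have "D *\<^sub>v (v + ?s \<cdot>\<^sub>v w) = w + ?s \<cdot>\<^sub>v (D *\<^sub>v w)"
        using v w by (simp add: mat_dim_simps w_def)
      moreover have "conjugate (v + ?s \<cdot>\<^sub>v w) = conjugate v + ?s \<cdot>\<^sub>v conjugate w"
        using v w by (simp add: conjugate_add_vec[of _ n] conjugate_smult_vec)
      moreover have "D *\<^sub>v w \<in> carrier_vec n" using D'(1) w by simp
      ultimately show ?thesis
        using v w
        by (simp add: scalar_prod_add_distrib[of _ n] add_scalar_prod_distrib[of _ n]
            smult_scalar_prod_distrib[of _ n] scalar_prod_smult_distrib[of _ n] w_def[symmetric] ac_simps
            distrib_left)
    qed
    also have "Re \<dots> = 2 * s * N + s\<^sup>2 * c"
      using 0 by (simp add: Dwv N_def c_def power2_eq_square)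
    finally show ?thesis
      using D'(3)[of "v + ?s \<cdot>\<^sub>v w"] v w by (simp add: less_eq_complex_def)
  qed
  have "N = 0"
  proof (rule ccontr)
    assume "N \<noteq> 0"
    \<comment> \<open>\<open>- N / (c + 1)\<close> is close to the minimiser \<open>- N / c\<close>;
      the added 1 avoids dividing by zero when \<open>c\<close> vanishes.\<close>
    have "2 * (- N / (c + 1)) * N + (- N / (c + 1))\<^sup>2 * c = - (N\<^sup>2 * (c + 2) / (c + 1)\<^sup>2)"
      using c by (simp add: divide_simps power2_eq_square) (simp add: algebra_simps)
    moreover have "0 < N\<^sup>2 * (c + 2) / (c + 1)\<^sup>2" using c \<open>N \<noteq> 0\<close> by simp
    ultimately show False using ineq[of "- N / (c + 1)"] by linarith
  qed
  then have "w = 0\<^sub>v n"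
    using cscalar_prod_self_real(1)[OF w] by (auto simp: N_def)
  then show ?thesis by (simp add: w_def)
qed

lemma quad_poly_carrier [simp]:
  "M \<in> carrier_mat n n \<Longrightarrow> D \<in> carrier_mat n n \<Longrightarrow> K \<in> carrier_mat n n \<Longrightarrow>
    quad_poly M D K z \<in> carrier_mat n n"
  by (simp add: quad_poly_def)

lemma hermitian_form_real:
  fixes A :: "complex mat"
  assumes A: "A \<in> carrier_mat n n" "mat_adjoint A = A" and v: "v \<in> carrier_vec n"
  shows "Im ((A *\<^sub>v v) \<bullet>c v) = 0"
proof -
  have "conjugate ((A *\<^sub>v v) \<bullet>c v) = conjugate (conjugate v \<bullet> (A *\<^sub>v v))"
    using A v by (simp add: comm_scalar_prod[of _ n])
  also have "\<dots> = v \<bullet>c (A *\<^sub>v v)" using A v by (intro conjugate_conjugate_sprod[of _ n]) auto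
  also have "\<dots> = (A *\<^sub>v v) \<bullet>c v"
    using cscalar_prod_mat_adjoint[OF A(1) v v] A(2) by simp
  finally show ?thesis by (simp add: complex_eq_iff)
qed

lemma quad_poly_mult_vec:
  assumes "M \<in> carrier_mat n n" "D \<in> carrier_mat n n" "K \<in> carrier_mat n n" "v \<in> carrier_vec n"
  shows "quad_poly M D K z *\<^sub>v v = (z\<^sup>2 \<cdot>\<^sub>m M + K) *\<^sub>v v + z \<cdot>\<^sub>v (D *\<^sub>v v)"
  using assms carrier_matD[OF assms(1)] carrier_matD[OF assms(2)] carrier_matD[OF assms(3)]
  unfolding quad_poly_def by (intro eq_vecI) (simp_all add: mat_dim_simps)

lemma imaginary_square: "z \<in> {\<i> * complex_of_real \<omega>, - (\<i> * complex_of_real \<omega>)} \<Longrightarrow> z\<^sup>2 = - (complex_of_real \<omega>)\<^sup>2"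
  by (auto simp: power_mult_distrib)

text \<open>Since \<open>z\<^sup>2\<close> is real, \<open>z\<^sup>2 \<cdot>\<^sub>m M + K\<close>
  is Hermitian and contributes nothing to the imaginary part. Semidefiniteness upgrades the
  vanishing form of \<open>D\<close> to \<open>D *\<^sub>v v = 0\<^sub>v n\<close>, after which the
  other summand vanishes too.\<close>

lemma undamped_kernel:
  assumes M: "M \<in> carrier_mat n n" "mat_adjoint M = M" and D: "pos_semidef n D"
    and K: "K \<in> carrier_mat n n" "mat_adjoint K = K"
    and omega: "\<omega> \<noteq> 0" and z: "z \<in> {\<i> * complex_of_real \<omega>, - (\<i> * complex_of_real \<omega>)}"
    and v: "v \<in> carrier_vec n"
  shows "quad_poly M D K z *\<^sub>v v = 0\<^sub>v n \<longleftrightarrow> (z\<^sup>2 \<cdot>\<^sub>m M + K) *\<^sub>v v = 0\<^sub>v n \<and> D *\<^sub>v v = 0\<^sub>v n"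
proof
  note D' = pos_semidefD[OF D]
  note [simp] = carrier_matD[OF M(1)] carrier_matD[OF K(1)] carrier_matD[OF D'(1)]
  let ?P0 = "z\<^sup>2 \<cdot>\<^sub>m M + K"
  assume 0: "quad_poly M D K z *\<^sub>v v = 0\<^sub>v n"
  have P0: "?P0 \<in> carrier_mat n n" "mat_adjoint ?P0 = ?P0"
    using M K imaginary_square[OF z] by (simp_all add: mat_adjoint_add mat_adjoint_smult)
  have c: "?P0 *\<^sub>v v \<in> carrier_vec n" "D *\<^sub>v v \<in> carrier_vec n"
    using P0 D'(1) v by simp_all
  have "0 = (quad_poly M D K z *\<^sub>v v) \<bullet>c v" using 0 v by simp
  also have "\<dots> = (?P0 *\<^sub>v v) \<bullet>c v + z * ((D *\<^sub>v v) \<bullet>c v)"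
    unfolding quad_poly_mult_vec[OF M(1) D'(1) K(1) v]
    using c v by (simp add: cscalar_prod_add_left[of _ n] smult_scalar_prod_distrib[of _ n])
  finally have "Im (z * ((D *\<^sub>v v) \<bullet>c v)) = 0"
    using hermitian_form_real[OF P0 v] by (metis add_0 plus_complex.simps(2) zero_complex.simps(2))
  then have "(D *\<^sub>v v) \<bullet>c v = 0"
    using D'(3)[OF v] omega z by (auto simp: complex_eq_iff less_eq_complex_def)
  then have Dv: "D *\<^sub>v v = 0\<^sub>v n" by (rule pos_semidef_form_zero[OF D v])
  then show "?P0 *\<^sub>v v = 0\<^sub>v n \<and> D *\<^sub>v v = 0\<^sub>v n"
    using 0 c unfolding quad_poly_mult_vec[OF M(1) D'(1) K(1) v] by (simp add: smult_zero_vec_dim)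
next
  assume "(z\<^sup>2 \<cdot>\<^sub>m M + K) *\<^sub>v v = 0\<^sub>v n \<and> D *\<^sub>v v = 0\<^sub>v n"
  then show "quad_poly M D K z *\<^sub>v v = 0\<^sub>v n"
    unfolding quad_poly_mult_vec[OF M(1) pos_semidefD(1)[OF D] K(1) v] by (simp add: smult_zero_vec_dim)
qed

text \<open>Full row rank makes the columns span everything, so \<open>y = R x\<close> for some
  \<open>x\<close>, and the squared norm of \<open>y\<close> pairs \<open>x\<close> with the adjoint
  of \<open>R\<close> applied to \<open>y\<close>, which is zero.\<close>

lemma full_row_rank_adjoint_inj:
  fixes R :: "complex mat"
  assumes R: "R \<in> carrier_mat n m" and rank: "vec_space.rank n R = n"
    and y: "y \<in> carrier_vec n" and 0: "mat_adjoint R *\<^sub>v y = 0\<^sub>v m"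
  shows "y = 0\<^sub>v n"
proof -
  interpret vec_space "TYPE(complex)" n .
  have cols: "set (cols R) \<subseteq> carrier_vec n" using R cols_dim by blast
  \<comment> \<open>The rank is the size of a maximal independent set of columns. Here it has
    \<open>n\<close> elements and is therefore a basis.\<close>
  obtain S where S: "maximal S (\<lambda>T. T \<subseteq> set (cols R) \<and> lin_indpt T)"
    using maximal_exists[of "\<lambda>T. T \<subseteq> set (cols R) \<and> lin_indpt T" "card (set (cols R))" "{}"]
    by (metis (no_types, lifting) List.finite_set card_mono empty_iff empty_subsetI finite_lin_indpt2
        rev_finite_subset)
  then have S': "S \<subseteq> set (cols R)" "lin_indpt S" by (auto simp: maximal_def)
  have "card S = n" using rank_card_indpt[OF R S] rank by simp
  then have "basis S"
    using S' cols by (intro dim_li_is_basis) (auto simp: dim_is_n intro: finite_subset)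
  then have "carrier_vec n \<subseteq> span (set (cols R))"
    using span_is_monotone[OF S'(1)] by (auto simp: basis_def)
  then have "y \<in> col_space R" using y by (auto simp: col_space_def)
  then obtain x where x: "x \<in> carrier_vec m" "y = R *\<^sub>v x"
    using col_space_eq[OF R] R by auto
  have "y \<bullet>c y = x \<bullet>c (mat_adjoint R *\<^sub>v y)"
    using cscalar_prod_mat_adjoint[OF R x(1) y] x(2) by simp
  then have "y \<bullet>c y = 0" using x(1) by (simp add: 0)
  then show ?thesis using y by simp
qed

text \<open>Zero rows pad \<open>A\<close> to a square singular matrix with the same kernel.\<close>

lemma wide_matrix_kernel:
  fixes A :: "complex mat"
  assumes A: "A \<in> carrier_mat m p" and mp: "m < p"
  obtains u where "u \<in> carrier_vec p" "u \<noteq> 0\<^sub>v p" "A *\<^sub>v u = 0\<^sub>v m"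
proof -
  let ?A = "A @\<^sub>r 0\<^sub>m (p - m) p"
  have sq: "?A \<in> carrier_mat p p" using carrier_append_rows[OF A, of "0\<^sub>m (p - m) p" "p - m"] mp by simp
  \<comment> \<open>Row \<open>m\<close> is the first padded row; it exists because
    \<open>m < p\<close>.\<close>
  have "?A = mat\<^sub>r p p (\<lambda>i. if i = m then 0\<^sub>v p else row ?A i)"
    using A mp by (intro eq_matI) (auto simp: append_rows_def)
  also have "det \<dots> = 0"
    using sq mp by (intro det_row_0) auto
  finally have "det ?A = 0" .
  then obtain u where u: "u \<in> carrier_vec p" "u \<noteq> 0\<^sub>v p" "?A *\<^sub>v u = 0\<^sub>v p"
    using det_0_iff_vec_prod_zero[OF sq] by blast
  have split0: "0\<^sub>v m @\<^sub>v 0\<^sub>v (p - m) = (0\<^sub>v p :: complex vec)"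
    using mp by (intro eq_vecI) auto
  have "(A *\<^sub>v u) @\<^sub>v (0\<^sub>m (p - m) p *\<^sub>v u) = 0\<^sub>v m @\<^sub>v 0\<^sub>v (p - m)"
    using mat_mult_append[OF A _ u(1), of "0\<^sub>m (p - m) p" "p - m"] u(3) split0 by simp
  then have "A *\<^sub>v u = 0\<^sub>v m"
    using A u(1) by (subst (asm) append_vec_eq[of _ m]) auto
  then show ?thesis using that u by blast
qed

subsection \<open>Block matrices\<close>

lemma dim_block_row [simp]:
  "dim_row (block_row A B) = dim_row A" "dim_col (block_row A B) = dim_col A + dim_col B"
  by (simp_all add: block_row_def)

lemma index_block_row [simp]:
  "i < dim_row A \<Longrightarrow> j < dim_col A + dim_col B \<Longrightarrow>
    block_row A B $$ (i, j) = (if j < dim_col A then A $$ (i, j) else B $$ (i, j - dim_col A))"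
  by (simp add: block_row_def)

lemma block_row_carrier [simp]:
  "A \<in> carrier_mat n k \<Longrightarrow> B \<in> carrier_mat n l \<Longrightarrow> block_row A B \<in> carrier_mat n (k + l)"
  by (intro carrier_matI) auto

lemma block_row_mult_vec:
  fixes A B :: "'a :: comm_ring_1 mat"
  assumes "A \<in> carrier_mat n k" "B \<in> carrier_mat n l" "x \<in> carrier_vec k" "y \<in> carrier_vec l"
  shows "block_row A B *\<^sub>v (x @\<^sub>v y) = A *\<^sub>v x + B *\<^sub>v y"
proof -
  have "block_row A B *\<^sub>v (x @\<^sub>v y) = (A *\<^sub>v x + B *\<^sub>v y) @\<^sub>v (0\<^sub>m 0 k *\<^sub>v x + 0\<^sub>m 0 l *\<^sub>v y)"
    unfolding block_row_def using assms by (simp add: four_block_mat_mult_vec[of _ n k _ l _ 0])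
  also have "\<dots> = A *\<^sub>v x + B *\<^sub>v y" using assms by (intro eq_vecI) auto
  finally show ?thesis .
qed

lemma dim_append_rows [simp]:
  "dim_row (A @\<^sub>r B) = dim_row A + dim_row B" "dim_col (A @\<^sub>r B) = dim_col A"
  by (simp_all add: append_rows_def)

lemma index_append_rows [simp]:
  "i < dim_row A + dim_row B \<Longrightarrow> j < dim_col A \<Longrightarrow>
    (A @\<^sub>r B) $$ (i, j) = (if i < dim_row A then A $$ (i, j) else B $$ (i - dim_row A, j))"
  by (simp add: append_rows_def)

lemma mat_adjoint_block_row:
  assumes "A \<in> carrier_mat n k" "B \<in> carrier_mat n l"
  shows "mat_adjoint (block_row A B) = mat_adjoint A @\<^sub>r mat_adjoint B"
  using assms by (intro eq_matI) auto

lemma append_rows_mult_block_row: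
  fixes A B C D :: "'a :: semiring_0 mat"
  assumes "A \<in> carrier_mat k n" "B \<in> carrier_mat l n" "C \<in> carrier_mat n r" "D \<in> carrier_mat n s"
  shows "(A @\<^sub>r B) * block_row C D = four_block_mat (A * C) (A * D) (B * C) (B * D)"
proof (rule eq_matI)
  fix i j
  assume "i < dim_row (four_block_mat (A * C) (A * D) (B * C) (B * D))"
    "j < dim_col (four_block_mat (A * C) (A * D) (B * C) (B * D))"
  then have ij: "i < k + l" "j < r + s" using assms by auto
  have "row (A @\<^sub>r B) i = (if i < k then row A i else row B (i - k))"
    using assms ij by (intro eq_vecI) auto
  moreover have "col (block_row C D) j = (if j < r then col C j else col D (j - r))"
    using assms ij by (intro eq_vecI) auto
  ultimately show "((A @\<^sub>r B) * block_row C D) $$ (i, j)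
      = four_block_mat (A * C) (A * D) (B * C) (B * D) $$ (i, j)"
    using assms ij by auto
qed (use assms in auto)

lemma four_block_mat_eqD:
  assumes "four_block_mat A B C D = four_block_mat A' B' C' D'"
    "A \<in> carrier_mat k r" "B \<in> carrier_mat k s" "C \<in> carrier_mat l r" "D \<in> carrier_mat l s"
    "A' \<in> carrier_mat k r" "B' \<in> carrier_mat k s" "C' \<in> carrier_mat l r" "D' \<in> carrier_mat l s"
  shows "A = A'" "B = B'" "C = C'" "D = D'"
proof -
  note eq = arg_cong[OF assms(1), of "\<lambda>X. X $$ (i, j)" for i j]
  show "A = A'"
  proof (rule eq_matI)
    fix i j assume "i < dim_row A'" "j < dim_col A'"
    then show "A $$ (i, j) = A' $$ (i, j)" using eq[of i j] assms(2-) by simp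
  qed (use assms(2-) in simp_all)
  show "B = B'"
  proof (rule eq_matI)
    fix i j assume "i < dim_row B'" "j < dim_col B'"
    then show "B $$ (i, j) = B' $$ (i, j)" using eq[of i "r + j"] assms(2-) by simp
  qed (use assms(2-) in simp_all)
  show "C = C'"
  proof (rule eq_matI)
    fix i j assume "i < dim_row C'" "j < dim_col C'"
    then show "C $$ (i, j) = C' $$ (i, j)" using eq[of "k + i" j] assms(2-) by simp
  qed (use assms(2-) in simp_all)
  show "D = D'"
  proof (rule eq_matI)
    fix i j assume "i < dim_row D'" "j < dim_col D'"
    then show "D $$ (i, j) = D' $$ (i, j)" using eq[of "k + i" "r + j"] assms(2-) by simp
  qed (use assms(2-) in simp_all)
qed

text \<open>Applied to \<open>M\<close>, to the values of \<open>P\<close> and to the damping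
  matrix, it reduces each congruence to four separate blocks.\<close>

lemma adjoint_block_congruence:
  fixes X1 X2 A :: "'a :: conjugatable_field mat"
  assumes X1: "X1 \<in> carrier_mat n q" and X2: "X2 \<in> carrier_mat n p" and A: "A \<in> carrier_mat n n"
  shows "mat_adjoint (block_row X1 X2) * A * block_row X1 X2
    = four_block_mat (mat_adjoint X1 * A * X1) (mat_adjoint X1 * A * X2)
        (mat_adjoint X2 * A * X1) (mat_adjoint X2 * A * X2)"
proof -
  note [simp] = carrier_matD[OF X1] carrier_matD[OF X2] carrier_matD[OF A]
  have "A * block_row X1 X2 = block_row (A * X1) (A * X2)"
  proof (rule eq_matI)
    fix i j assume "i < dim_row (block_row (A * X1) (A * X2))" "j < dim_col (block_row (A * X1) (A * X2))"
    then have ij: "i < n" "j < q + p" by auto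
    moreover have "col (block_row X1 X2) j = (if j < q then col X1 j else col X2 (j - q))"
      using ij by (intro eq_vecI) auto
    ultimately show "(A * block_row X1 X2) $$ (i, j) = block_row (A * X1) (A * X2) $$ (i, j)"
      by auto
  qed auto
  then have "mat_adjoint (block_row X1 X2) * A * block_row X1 X2
      = (mat_adjoint X1 @\<^sub>r mat_adjoint X2) * block_row (A * X1) (A * X2)"
    by (simp add: mult_assoc_dim mat_adjoint_block_row[OF X1 X2])
  also have "\<dots> = four_block_mat (mat_adjoint X1 * (A * X1)) (mat_adjoint X1 * (A * X2))
        (mat_adjoint X2 * (A * X1)) (mat_adjoint X2 * (A * X2))"
    using X1 X2 A by (intro append_rows_mult_block_row[of _ q n _ p _ q _ p]) (simp_all add: mult_carrier_mat[of _ n n])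
  finally show ?thesis by (simp add: mult_assoc_dim)
qed

section \<open>Determinants, \<open>M\<close>-unitary congruences and the
  \<open>M\<close>-orthonormal complement\<close>

lemma det_diag2:
  fixes A B :: "'a :: idom mat"
  assumes "A \<in> carrier_mat n n" "B \<in> carrier_mat m m"
  shows "det (diag2 A B) = det A * det B"
  unfolding diag2_def using assms by (intro det_four_block_mat_lower_left_zero) auto

text \<open>A one-sided inverse of a square matrix is two-sided. This gives invertibility of
  \<open>X\<close> and recovers a vector from its image under the adjoint of
  \<open>X\<close>.\<close>

lemma m_unitary_right_inverse:
  assumes M: "M \<in> carrier_mat n n" and X: "m_unitary n M X"
  shows "M * X * mat_adjoint X = 1\<^sub>m n"
proof -
  have c: "X \<in> carrier_mat n n" and eq: "mat_adjoint X * M * X = 1\<^sub>m n" using X by (auto simp: m_unitary_def)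
  note [simp] = carrier_matD[OF M] carrier_matD[OF c]
  show ?thesis
    using M c eq by (intro mat_mult_left_right_inverse[of "mat_adjoint X" n "M * X"]) (simp_all add: mult_assoc_dim)
qed

lemma m_unitary_det_congruence:
  assumes M: "M \<in> carrier_mat n n" and X: "m_unitary n M X" and A: "A \<in> carrier_mat n n"
  shows "det (mat_adjoint X * A * X) = 0 \<longleftrightarrow> det A = 0"
proof -
  have c: "X \<in> carrier_mat n n" using X by (simp add: m_unitary_def)
  have "det M * det X * det (mat_adjoint X) = 1"
    using arg_cong[OF m_unitary_right_inverse[OF M X], of det] M c
    by (simp add: det_mult[of _ n])
  then have "det X \<noteq> 0" "det (mat_adjoint X) \<noteq> 0" by auto
  moreover have "det (mat_adjoint X * A * X) = det (mat_adjoint X) * det A * det X"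
    using A c by (simp add: det_mult[of _ n] mult_carrier_mat[of _ n n _ n])
  ultimately show ?thesis by simp
qed

text \<open>A blockwise Gram-Schmidt step in the \<open>M\<close> inner product: subtract from
  \<open>Q1\<close> its \<open>M\<close>-projection onto the range of \<open>Q2\<close>, then
  normalise by the inverse root of the Gram matrix \<open>C\<close>.\<close>

lemma M_orthonormal_complement:
  assumes M: "pos_def n M" and Q1: "Q1 \<in> carrier_mat n q" and Q2: "Q2 \<in> carrier_mat n p"
    and inj2: "\<And>b. b \<in> carrier_vec p \<Longrightarrow> Q2 *\<^sub>v b = 0\<^sub>v n \<Longrightarrow> b = 0\<^sub>v p"
    and indep: "\<And>a b. a \<in> carrier_vec q \<Longrightarrow> b \<in> carrier_vec p \<Longrightarrow> Q1 *\<^sub>v a = Q2 *\<^sub>v b \<Longrightarrow> a = 0\<^sub>v q"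
  obtains X1 where "X1 \<in> carrier_mat n q" "mat_adjoint X1 * M * X1 = 1\<^sub>m q"
    "mat_adjoint X1 * M * Q2 = 0\<^sub>m q p"
proof -
  note M' = pos_defD[OF M]
  define B where "B = mat_adjoint Q2 * M * Q2"
  have B: "pos_def p B" unfolding B_def by (rule pos_def_congruence[OF M Q2 inj2])
  define Y where "Y = mat_inv_sqrt B"
  note Y = mat_inv_sqrt[OF B, folded Y_def]
  note [simp] = carrier_matD[OF M'(1)] carrier_matD[OF Q1] carrier_matD[OF Q2]
    carrier_matD[OF pos_defD(1)[OF B]] carrier_matD[OF Y(1)]
    carrier_matD[OF pos_defD(1)[OF mat_sqrt(1)[OF B]]]
  \<comment> \<open>\<open>Y * Y\<close> is the inverse of \<open>B\<close>, so
    \<open>Q2 * F\<close> is the \<open>M\<close>-orthogonal projection of the columns of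
    \<open>Q1\<close>.\<close>
  define F where "F = Y * (Y * (mat_adjoint Q2 * (M * Q1)))"
  have [simp]: "dim_row F = p" "dim_col F = q" by (simp_all add: F_def)
  define Z where "Z = Q1 - Q2 * F"
  have Z: "Z \<in> carrier_mat n q" by (rule carrier_matI) (simp_all add: Z_def)
  note [simp] = carrier_matD[OF Z]
  have BF: "B * F = mat_adjoint Q2 * (M * Q1)"
    unfolding F_def by (simp flip: mult_assoc_dim add: Y(7) Y(3))
  have "mat_adjoint Q2 * (M * Z) = mat_adjoint Q2 * (M * Q1) - B * F"
    by (simp add: Z_def mult_minus_dim B_def mult_assoc_dim)
  also have "\<dots> = 0\<^sub>m p q"
    unfolding BF by (intro eq_matI) (simp_all del: index_mult_mat(1))
  finally have Q2MZ: "mat_adjoint Q2 * (M * Z) = 0\<^sub>m p q" .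
  have ZMQ2: "mat_adjoint Z * (M * Q2) = 0\<^sub>m q p"
    using arg_cong[OF Q2MZ, of mat_adjoint] by (simp add: mat_adjoint_mult M'(2) mult_assoc_dim)
  define C where "C = mat_adjoint Z * M * Z"
  have C: "pos_def q C"
    unfolding C_def
  proof (rule pos_def_congruence[OF M Z])
    fix a assume a: "a \<in> carrier_vec q" "Z *\<^sub>v a = 0\<^sub>v n"
    \<comment> \<open>A null vector of \<open>Z\<close> would make a combination of the columns of
      \<open>Q1\<close> fall into the range of \<open>Q2\<close>, which \<open>indep\<close>
      excludes.\<close>
    have "Q1 *\<^sub>v a = Q2 *\<^sub>v (F *\<^sub>v a)"
    proof (rule eq_vecI)
      fix i assume "i < dim_vec (Q2 *\<^sub>v (F *\<^sub>v a))"
      then have i: "i < n" by simp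
      have "Z *\<^sub>v a = Q1 *\<^sub>v a - Q2 *\<^sub>v (F *\<^sub>v a)"
        using a(1) by (simp add: Z_def minus_mult_vec_dim mult_vec_assoc_dim)
      then have "(Q1 *\<^sub>v a) $ i - (Q2 *\<^sub>v (F *\<^sub>v a)) $ i = (Z *\<^sub>v a) $ i"
        using i by (simp del: index_mult_mat_vec)
      also have "\<dots> = 0" using i by (simp only: a(2) index_zero_vec)
      finally show "(Q1 *\<^sub>v a) $ i = (Q2 *\<^sub>v (F *\<^sub>v a)) $ i"
        by (simp del: index_mult_mat_vec)
    qed simp
    then show "a = 0\<^sub>v q" using a(1) by (intro indep) (auto intro: carrier_vecI)
  qed
  define W where "W = mat_inv_sqrt C"
  note W = mat_inv_sqrt[OF C, folded W_def]
  note [simp] = carrier_matD[OF W(1)] carrier_matD[OF pos_defD(1)[OF C]]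
  show thesis
  proof (rule that)
    show "Z * W \<in> carrier_mat n q" using Z W(1) by simp
    have "mat_adjoint (Z * W) * M * (Z * W) = W * C * W"
      by (simp add: mat_adjoint_mult W(2) C_def mult_assoc_dim)
    then show "mat_adjoint (Z * W) * M * (Z * W) = 1\<^sub>m q" by (simp add: W(5))
    have "mat_adjoint (Z * W) * M * Q2 = W * (mat_adjoint Z * (M * Q2))"
      by (simp add: mat_adjoint_mult W(2) mult_assoc_dim)
    then show "mat_adjoint (Z * W) * M * Q2 = 0\<^sub>m q p" by (simp add: ZMQ2)
  qed
qed

text \<open>Pairing the equation with a null vector gives a scalar quadratic with coefficients
  \<open>a\<close>, \<open>t * b\<close> and \<open>\<omega>\<^sup>2 * a\<close>, all positive,
  whose roots lie in the open left half-plane.\<close>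

lemma damped_eigenvalue_Re_neg:
  assumes A: "pos_def p A" and t: "0 < t" and omega: "\<omega> \<noteq> 0"
    and z: "z \<in> eigvals (\<lambda>z. z\<^sup>2 \<cdot>\<^sub>m 1\<^sub>m p + (z * complex_of_real t) \<cdot>\<^sub>m A + (complex_of_real \<omega>)\<^sup>2 \<cdot>\<^sub>m 1\<^sub>m p)"
  shows "Re z < 0"
proof -
  note A' = pos_defD[OF A]
  note [simp] = carrier_matD[OF A'(1)]
  let ?L = "z\<^sup>2 \<cdot>\<^sub>m 1\<^sub>m p + (z * complex_of_real t) \<cdot>\<^sub>m A + (complex_of_real \<omega>)\<^sup>2 \<cdot>\<^sub>m 1\<^sub>m p"
  have "?L \<in> carrier_mat p p" by (rule carrier_matI) simp_all
  then obtain u where u: "u \<in> carrier_vec p" "u \<noteq> 0\<^sub>v p" "?L *\<^sub>v u = 0\<^sub>v p"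
    using z det_0_iff_vec_prod_zero[of ?L p] by (auto simp: eigvals_def)
  have Au: "A *\<^sub>v u \<in> carrier_vec p" using A'(1) u by simp
  define a b where "a = Re (u \<bullet>c u)" and "b = Re ((A *\<^sub>v u) \<bullet>c u)"
  have a: "u \<bullet>c u = complex_of_real a" "0 < a"
    using cscalar_prod_self_real[OF u(1,2)] by (auto simp: a_def complex_eq_iff)
  have b: "(A *\<^sub>v u) \<bullet>c u = complex_of_real b" "0 < b"
    using A'(3)[OF u(1,2)] by (auto simp: b_def complex_eq_iff less_complex_def)
  have "?L *\<^sub>v u = z\<^sup>2 \<cdot>\<^sub>v u + (z * complex_of_real t) \<cdot>\<^sub>v (A *\<^sub>v u) + (complex_of_real \<omega>)\<^sup>2 \<cdot>\<^sub>v u"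
    using u(1) by (simp add: mat_dim_simps)
  then have Lu: "z\<^sup>2 \<cdot>\<^sub>v u + (z * complex_of_real t) \<cdot>\<^sub>v (A *\<^sub>v u) + (complex_of_real \<omega>)\<^sup>2 \<cdot>\<^sub>v u = 0\<^sub>v p"
    by (simp only: u(3))
  have "0 = (z\<^sup>2 \<cdot>\<^sub>v u + (z * complex_of_real t) \<cdot>\<^sub>v (A *\<^sub>v u) + (complex_of_real \<omega>)\<^sup>2 \<cdot>\<^sub>v u) \<bullet>c u"
    unfolding Lu using u(1) by simp
  also have "\<dots> = z\<^sup>2 * a + (z * complex_of_real t) * b + (complex_of_real \<omega>)\<^sup>2 * a"
    using u Au by (simp add: cscalar_prod_add_left[of _ p] smult_scalar_prod_distrib[of _ p] a b)
  finally have eq: "z\<^sup>2 * a + (z * complex_of_real t) * b + (complex_of_real \<omega>)\<^sup>2 * a = 0" by simp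
  define x y where "x = Re z" and "y = Im z"
  have re: "(x\<^sup>2 - y\<^sup>2) * a + x * t * b + \<omega>\<^sup>2 * a = 0" and im: "y * (2 * x * a + t * b) = 0"
    using eq by (auto simp: complex_eq_iff x_def y_def power2_eq_square algebra_simps)
  show ?thesis
  proof (rule ccontr)
    assume "\<not> Re z < 0"
    then have x: "0 \<le> x" by (simp add: x_def)
    \<comment> \<open>If \<open>x\<close> were nonnegative, the imaginary part would force
      \<open>y = 0\<close>, and the real part would then be a sum of nonnegative terms with a
      positive last one.\<close>
    have "0 < 2 * x * a + t * b" using x a b t by (simp add: add_nonneg_pos)
    then have "y = 0" using im by auto
    moreover have "0 \<le> x\<^sup>2 * a" "0 \<le> x * t * b" "0 < \<omega>\<^sup>2 * a" using x a b t omega by simp_all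
    ultimately show False using re by simp
  qed
qed

lemma append_rows_eqD:
  assumes "A @\<^sub>r B = A' @\<^sub>r B'" "A \<in> carrier_mat k n" "B \<in> carrier_mat l n"
    "A' \<in> carrier_mat k n" "B' \<in> carrier_mat l n"
  shows "A = A'" "B = B'"
  using four_block_mat_eqD[of A "0\<^sub>m k 0" B "0\<^sub>m l 0" A' "0\<^sub>m k 0" B' "0\<^sub>m l 0" k n 0 l] assms
  by (simp_all add: append_rows_def)

lemma mult_block_row:
  fixes A B C :: "'a :: semiring_0 mat"
  assumes "C \<in> carrier_mat k n" "A \<in> carrier_mat n r" "B \<in> carrier_mat n s"
  shows "C * block_row A B = block_row (C * A) (C * B)"
proof (rule eq_matI)
  fix i j assume "i < dim_row (block_row (C * A) (C * B))" "j < dim_col (block_row (C * A) (C * B))"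
  then have ij: "i < k" "j < r + s" using assms by auto
  moreover have "col (block_row A B) j = (if j < r then col A j else col B (j - r))"
    using assms ij by (intro eq_vecI) auto
  ultimately show "(C * block_row A B) $$ (i, j) = block_row (C * A) (C * B) $$ (i, j)"
    using assms by auto
qed (use assms in auto)

lemma block_row_eq_zeroD:
  assumes "block_row A B = 0\<^sub>m n (r + s)" "A \<in> carrier_mat n r" "B \<in> carrier_mat n s"
  shows "A = 0\<^sub>m n r" "B = 0\<^sub>m n s"
proof -
  note eq = arg_cong[OF assms(1), of "\<lambda>X. X $$ (i, j)" for i j]
  show "A = 0\<^sub>m n r"
  proof (rule eq_matI)
    fix i j assume "i < dim_row (0\<^sub>m n r :: 'a mat)" "j < dim_col (0\<^sub>m n r :: 'a mat)"
    then show "A $$ (i, j) = 0\<^sub>m n r $$ (i, j)" using eq[of i j] assms(2-) by simp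
  qed (use assms(2-) in simp_all)
  show "B = 0\<^sub>m n s"
  proof (rule eq_matI)
    fix i j assume "i < dim_row (0\<^sub>m n s :: 'a mat)" "j < dim_col (0\<^sub>m n s :: 'a mat)"
    then show "B $$ (i, j) = 0\<^sub>m n s $$ (i, j)" using eq[of i "r + j"] assms(2-) by simp
  qed (use assms(2-) in simp_all)
qed

lemma append_rows_mult:
  fixes A B C :: "'a :: semiring_0 mat"
  assumes "A \<in> carrier_mat k n" "B \<in> carrier_mat l n" "C \<in> carrier_mat n r"
  shows "(A @\<^sub>r B) * C = (A * C) @\<^sub>r (B * C)"
proof (rule eq_matI)
  fix i j assume "i < dim_row (A * C @\<^sub>r B * C)" "j < dim_col (A * C @\<^sub>r B * C)"
  then have ij: "i < k + l" "j < r" using assms by auto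
  moreover have "row (A @\<^sub>r B) i = (if i < k then row A i else row B (i - k))"
    using assms ij by (intro eq_vecI) auto
  ultimately show "((A @\<^sub>r B) * C) $$ (i, j) = (A * C @\<^sub>r B * C) $$ (i, j)"
    using assms by auto
qed (use assms in auto)

subsection \<open>The null space from the QR factorization\<close>

text \<open>The blocks of both unitarity identities. The last clause is the resolution of the
  identity into the projections onto the two column ranges.\<close>

lemma unitary_block_row:
  assumes Q: "unitary_mat n (block_row Q1 Q2)"
    and Q1: "Q1 \<in> carrier_mat n q" and Q2: "Q2 \<in> carrier_mat n p"
  shows "q + p = n" "mat_adjoint Q1 * Q1 = 1\<^sub>m q" "mat_adjoint Q1 * Q2 = 0\<^sub>m q p"
    "mat_adjoint Q2 * Q2 = 1\<^sub>m p"
    "\<And>v. v \<in> carrier_vec n \<Longrightarrow> Q1 *\<^sub>v (mat_adjoint Q1 *\<^sub>v v) + Q2 *\<^sub>v (mat_adjoint Q2 *\<^sub>v v) = v"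
proof -
  note U = unitary_matD[OF Q]
  note [simp] = carrier_matD[OF Q1] carrier_matD[OF Q2]
  show qp: "q + p = n" using carrier_matD(2)[OF U(1)] by simp
  have "four_block_mat (mat_adjoint Q1 * Q1) (mat_adjoint Q1 * Q2) (mat_adjoint Q2 * Q1) (mat_adjoint Q2 * Q2)
      = mat_adjoint (block_row Q1 Q2) * block_row Q1 Q2"
    using append_rows_mult_block_row[of "mat_adjoint Q1" q n "mat_adjoint Q2" p Q1 q Q2 p] Q1 Q2
    by (simp add: mat_adjoint_block_row[OF Q1 Q2])
  also have "\<dots> = four_block_mat (1\<^sub>m q) (0\<^sub>m q p) (0\<^sub>m p q) (1\<^sub>m p)"
    by (simp add: U(2) qp)
  finally have eq: "four_block_mat (mat_adjoint Q1 * Q1) (mat_adjoint Q1 * Q2) (mat_adjoint Q2 * Q1) (mat_adjoint Q2 * Q2)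
      = four_block_mat (1\<^sub>m q) (0\<^sub>m q p) (0\<^sub>m p q) (1\<^sub>m p)" .
  have c: "mat_adjoint Q1 * Q1 \<in> carrier_mat q q" "mat_adjoint Q1 * Q2 \<in> carrier_mat q p"
    "mat_adjoint Q2 * Q1 \<in> carrier_mat p q" "mat_adjoint Q2 * Q2 \<in> carrier_mat p p"
    by (rule carrier_matI; simp)+
  note four = four_block_mat_eqD[OF eq c one_carrier_mat zero_carrier_mat zero_carrier_mat one_carrier_mat]
  show "mat_adjoint Q1 * Q1 = 1\<^sub>m q" "mat_adjoint Q1 * Q2 = 0\<^sub>m q p" "mat_adjoint Q2 * Q2 = 1\<^sub>m p"
    by (rule four)+
  fix v :: "complex vec" assume v: "v \<in> carrier_vec n"
  have c: "mat_adjoint Q1 *\<^sub>v v \<in> carrier_vec q" "mat_adjoint Q2 *\<^sub>v v \<in> carrier_vec p"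
    by (rule carrier_vecI; simp)+
  have "Q1 *\<^sub>v (mat_adjoint Q1 *\<^sub>v v) + Q2 *\<^sub>v (mat_adjoint Q2 *\<^sub>v v)
      = block_row Q1 Q2 *\<^sub>v (mat_adjoint (block_row Q1 Q2) *\<^sub>v v)"
    using mat_mult_append[of "mat_adjoint Q1" q n "mat_adjoint Q2" p v] Q1 Q2 v
    by (simp add: mat_adjoint_block_row[OF Q1 Q2] block_row_mult_vec[OF Q1 Q2 c])
  also have "\<dots> = v"
    using v U(1) by (simp flip: mult_vec_assoc_dim add: U(3) qp)
  finally show "Q1 *\<^sub>v (mat_adjoint Q1 *\<^sub>v v) + Q2 *\<^sub>v (mat_adjoint Q2 *\<^sub>v v) = v" .
qed

text \<open>Compare the row blocks of \<open>QR\<close>. For \<open>v\<close> in the left null space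
  of \<open>A\<close>, the component along \<open>Q1\<close> is annihilated by the adjoint of
  \<open>R\<close>, hence zero, and only the component along \<open>Q2\<close> is left.\<close>

lemma QR_null_space:
  fixes A :: "complex mat"
  assumes Q: "unitary_mat n (block_row Q1 Q2)"
    and Q1: "Q1 \<in> carrier_mat n q" and Q2: "Q2 \<in> carrier_mat n p" and A: "A \<in> carrier_mat n m"
    and R: "R \<in> carrier_mat q m" "vec_space.rank q R = q"
    and QR: "mat_adjoint (block_row Q1 Q2) * A = R @\<^sub>r 0\<^sub>m p m"
  shows "mat_adjoint Q2 * A = 0\<^sub>m p m"
    "\<And>v. v \<in> carrier_vec n \<Longrightarrow> mat_adjoint A *\<^sub>v v = 0\<^sub>v m \<Longrightarrow> v = Q2 *\<^sub>v (mat_adjoint Q2 *\<^sub>v v)"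
proof -
  note [simp] = carrier_matD[OF Q1] carrier_matD[OF Q2] carrier_matD[OF A]
  have "mat_adjoint Q1 * A @\<^sub>r mat_adjoint Q2 * A = R @\<^sub>r 0\<^sub>m p m"
    using QR Q1 Q2 A by (simp add: mat_adjoint_block_row[OF Q1 Q2] append_rows_mult[of _ q n _ p _ m])
  moreover have "mat_adjoint Q1 * A \<in> carrier_mat q m" "mat_adjoint Q2 * A \<in> carrier_mat p m"
    by (rule carrier_matI; simp)+
  ultimately have Q1A: "mat_adjoint Q1 * A = R" and Q2A: "mat_adjoint Q2 * A = 0\<^sub>m p m"
    using append_rows_eqD[of "mat_adjoint Q1 * A" "mat_adjoint Q2 * A" R "0\<^sub>m p m" q m p] R(1) by simp_all
  show "mat_adjoint Q2 * A = 0\<^sub>m p m" by (rule Q2A)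
  have AQ1: "mat_adjoint A * Q1 = mat_adjoint R" and AQ2: "mat_adjoint A * Q2 = 0\<^sub>m m p"
    using arg_cong[OF Q1A, of mat_adjoint] arg_cong[OF Q2A, of mat_adjoint] by (simp_all add: mat_adjoint_mult)
  fix v assume v: "v \<in> carrier_vec n" "mat_adjoint A *\<^sub>v v = 0\<^sub>v m"
  let ?y = "mat_adjoint Q1 *\<^sub>v v" and ?w = "mat_adjoint Q2 *\<^sub>v v"
  have y: "?y \<in> carrier_vec q" by (rule carrier_vecI) simp
  have decomp: "Q1 *\<^sub>v ?y + Q2 *\<^sub>v ?w = v" using unitary_block_row(5)[OF Q Q1 Q2 v(1)] .
  have "mat_adjoint A *\<^sub>v (Q1 *\<^sub>v ?y + Q2 *\<^sub>v ?w) = (mat_adjoint A * Q1) *\<^sub>v ?y + (mat_adjoint A * Q2) *\<^sub>v ?w"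
    using v(1) by (simp add: mat_dim_simps)
  also have "\<dots> = mat_adjoint R *\<^sub>v ?y"
    using R(1) by (intro eq_vecI) (simp_all add: AQ1 AQ2)
  finally have "mat_adjoint R *\<^sub>v ?y = 0\<^sub>v m" using v(2) by (simp only: decomp)
  then have "?y = 0\<^sub>v q" by (rule full_row_rank_adjoint_inj[OF R y])
  moreover have "Q2 *\<^sub>v ?w \<in> carrier_vec n" by (rule carrier_vecI) simp
  ultimately show "v = Q2 *\<^sub>v ?w" using decomp by simp
qed

subsection \<open>Splitting off the undamped block\<close>

text \<open>The interface between the QR data and the congruence. \<open>KX2\<close> is the equation
  for the undamped polynomial at the eigenvalue, solved for \<open>K * X2\<close>;
  \<open>kernel_in_range\<close> says that the range of \<open>X2\<close> exhausts the undamped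
  kernel.\<close>

locale undamped_split =
  fixes n q p :: nat and M D K X1 X2 :: "complex mat" and \<omega> :: real
  assumes M: "pos_def n M" and D: "pos_semidef n D" and K: "pos_semidef n K"
    and omega: "\<omega> \<noteq> 0"
    and X1: "X1 \<in> carrier_mat n q" and X2: "X2 \<in> carrier_mat n p" and qp: "q + p = n"
    and X1MX1: "mat_adjoint X1 * M * X1 = 1\<^sub>m q" and X1MX2: "mat_adjoint X1 * M * X2 = 0\<^sub>m q p"
    and X2MX2: "mat_adjoint X2 * M * X2 = 1\<^sub>m p"
    and DX2: "D * X2 = 0\<^sub>m n p" and KX2: "K * X2 = (complex_of_real \<omega>)\<^sup>2 \<cdot>\<^sub>m (M * X2)"
    and kernel_in_range: "\<And>v. v \<in> carrier_vec n \<Longrightarrow>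
      ((\<i> * complex_of_real \<omega>)\<^sup>2 \<cdot>\<^sub>m M + K) *\<^sub>v v = 0\<^sub>v n \<Longrightarrow> D *\<^sub>v v = 0\<^sub>v n \<Longrightarrow>
      \<exists>w \<in> carrier_vec p. v = X2 *\<^sub>v w"
begin

abbreviation X where "X \<equiv> block_row X1 X2"
abbreviation P where "P \<equiv> quad_poly M D K"

lemma carriers: "M \<in> carrier_mat n n" "D \<in> carrier_mat n n" "K \<in> carrier_mat n n"
  using pos_defD(1)[OF M] pos_semidefD(1)[OF D] pos_semidefD(1)[OF K] by auto

lemma dims [simp]: "dim_row M = n" "dim_col M = n" "dim_row D = n" "dim_col D = n" "dim_row K = n"
  "dim_col K = n" "dim_row X1 = n" "dim_col X1 = q" "dim_row X2 = n" "dim_col X2 = p"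
  using carriers X1 X2 by auto

lemma dim_P [simp]: "dim_row (P z) = n" "dim_col (P z) = n"
  by (simp_all add: quad_poly_def)

lemma self_adjoint: "mat_adjoint M = M" "mat_adjoint D = D" "mat_adjoint K = K"
  using pos_defD(2)[OF M] pos_semidefD(2)[OF D] pos_semidefD(2)[OF K] by auto

lemma X2MX1: "mat_adjoint X2 * M * X1 = 0\<^sub>m p q"
  using arg_cong[OF X1MX2, of mat_adjoint] by (simp add: mat_adjoint_mult self_adjoint mult_assoc_dim)

lemma m_unitary_X: "m_unitary n M X"
  unfolding m_unitary_def
  using adjoint_block_congruence[OF X1 X2 carriers(1)] block_row_carrier[OF X1 X2] qp
  by (simp add: X1MX1 X1MX2 X2MX1 X2MX2)

text \<open>For every \<open>z\<close> the product is a scalar multiple of \<open>M * X2\<close>, so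
  \<open>M\<close>-orthogonality to \<open>X1\<close> passes to the off-diagonal block.\<close>

lemma P_X2: "P z * X2 = (z\<^sup>2 + (complex_of_real \<omega>)\<^sup>2) \<cdot>\<^sub>m (M * X2)"
proof -
  have "P z * X2 = z\<^sup>2 \<cdot>\<^sub>m (M * X2) + z \<cdot>\<^sub>m (D * X2) + K * X2"
    by (simp add: quad_poly_def mat_dim_simps)
  also have "\<dots> = (z\<^sup>2 + (complex_of_real \<omega>)\<^sup>2) \<cdot>\<^sub>m (M * X2)"
    unfolding DX2 KX2 by (intro eq_matI) (simp_all add: algebra_simps del: index_mult_mat(1))
  finally show ?thesis .
qed

text \<open>The coefficients are Hermitian, so the adjoint of \<open>P z\<close> is
  \<open>P (cnj z)\<close>; this is the adjoint of \<open>P_X2\<close> at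
  \<open>cnj z\<close>.\<close>

lemma X2_P: "mat_adjoint X2 * P z = (z\<^sup>2 + (complex_of_real \<omega>)\<^sup>2) \<cdot>\<^sub>m (mat_adjoint X2 * M)"
proof -
  have "mat_adjoint (P z) = P (cnj z)"
    by (simp add: quad_poly_def mat_adjoint_add mat_adjoint_smult self_adjoint)
  then have "mat_adjoint X2 * P z = mat_adjoint (P (cnj z) * X2)"
    by (metis dim_P(2) dims(9) mat_adjoint_adjoint mat_adjoint_mult)
  then show ?thesis
    by (simp add: P_X2 mat_adjoint_smult mat_adjoint_mult self_adjoint)
qed

lemma block_diag_P:
  "mat_adjoint X * P z * X
    = diag2 (mat_adjoint X1 * P z * X1) ((z\<^sup>2 + (complex_of_real \<omega>)\<^sup>2) \<cdot>\<^sub>m 1\<^sub>m p)"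
proof -
  have P: "P z \<in> carrier_mat n n" using carriers by simp
  have "mat_adjoint X1 * P z * X2 = 0\<^sub>m q p"
    using X1MX2 by (simp add: mult_assoc_dim P_X2 mult_smult_dim)
  moreover have "mat_adjoint X2 * P z * X1 = 0\<^sub>m p q"
    using X2MX1 by (simp add: X2_P smult_mult_dim)
  moreover have "mat_adjoint X2 * P z * X2 = (z\<^sup>2 + (complex_of_real \<omega>)\<^sup>2) \<cdot>\<^sub>m 1\<^sub>m p"
    using X2MX2 by (simp add: X2_P smult_mult_dim)
  ultimately show ?thesis
    by (simp add: adjoint_block_congruence[OF X1 X2 P] diag2_def)
qed

text \<open>Each block of the congruence of the damping matrix contains
  \<open>mat_adjoint X2 * M\<close> times \<open>X1\<close> or \<open>X2\<close>, or an adjoint of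
  that. Orthonormality leaves \<open>H\<close> in the last block alone. The scalar \<open>c\<close>
  will be \<open>z\<close> times \<open>t\<close>.\<close>

lemma block_diag_damped:
  assumes H: "H \<in> carrier_mat p p"
  shows "mat_adjoint X * (P z + c \<cdot>\<^sub>m (M * X2 * H * mat_adjoint X2 * M)) * X
    = diag2 (mat_adjoint X1 * P z * X1) (z\<^sup>2 \<cdot>\<^sub>m 1\<^sub>m p + c \<cdot>\<^sub>m H + (complex_of_real \<omega>)\<^sup>2 \<cdot>\<^sub>m 1\<^sub>m p)"
proof -
  note [simp] = carrier_matD[OF H]
  let ?G = "M * X2 * H * mat_adjoint X2 * M"
  have G: "?G \<in> carrier_mat n n" by (rule carrier_matI) simp_all
  have "mat_adjoint X1 * ?G * X1 = (mat_adjoint X1 * M * X2) * (H * (mat_adjoint X2 * M * X1))"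
    "mat_adjoint X1 * ?G * X2 = (mat_adjoint X1 * M * X2) * (H * (mat_adjoint X2 * M * X2))"
    "mat_adjoint X2 * ?G * X1 = (mat_adjoint X2 * M * X2) * (H * (mat_adjoint X2 * M * X1))"
    "mat_adjoint X2 * ?G * X2 = (mat_adjoint X2 * M * X2) * (H * (mat_adjoint X2 * M * X2))"
    by (simp_all add: mult_assoc_dim)
  then have XGX: "mat_adjoint X * ?G * X = diag2 (0\<^sub>m q q) H"
    by (simp add: adjoint_block_congruence[OF X1 X2 G] X1MX2 X2MX1 X2MX2 diag2_def)
  have "mat_adjoint X * (P z + c \<cdot>\<^sub>m ?G) * X = mat_adjoint X * P z * X + c \<cdot>\<^sub>m (mat_adjoint X * ?G * X)"
    using carrier_matD[OF G] qp by (simp only: mat_dim_simps dim_mat_adjoint dim_block_row dims dim_P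
        index_mult_mat index_smult_mat index_add_mat)
  also have "\<dots> = diag2 (mat_adjoint X1 * P z * X1) (z\<^sup>2 \<cdot>\<^sub>m 1\<^sub>m p + c \<cdot>\<^sub>m H + (complex_of_real \<omega>)\<^sup>2 \<cdot>\<^sub>m 1\<^sub>m p)"
    unfolding block_diag_P XGX diag2_def
    by (intro eq_matI) (auto simp del: index_mult_mat(1) simp: algebra_simps)
  finally show ?thesis .
qed

text \<open>The compressed equation implies the full one: \<open>P z\<close> applied to
  \<open>X1 u\<close> is annihilated by the adjoint of \<open>X1\<close> by assumption and by that
  of \<open>X2\<close> through decoupling, hence by the adjoint of the invertible
  \<open>X\<close>.\<close>

lemma Ptilde_det_nonzero:
  assumes z: "z \<in> {\<i> * complex_of_real \<omega>, - (\<i> * complex_of_real \<omega>)}"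
  shows "det (mat_adjoint X1 * P z * X1) \<noteq> 0"
proof
  have c: "mat_adjoint X1 * P z * X1 \<in> carrier_mat q q" by (rule carrier_matI) simp_all
  assume "det (mat_adjoint X1 * P z * X1) = 0"
  then obtain u where u: "u \<in> carrier_vec q" "u \<noteq> 0\<^sub>v q" "(mat_adjoint X1 * P z * X1) *\<^sub>v u = 0\<^sub>v q"
    using det_0_iff_vec_prod_zero[OF c] by blast
  let ?v = "X1 *\<^sub>v u"
  let ?y = "P z *\<^sub>v ?v"
  have v: "?v \<in> carrier_vec n" and y: "?y \<in> carrier_vec n" by (rule carrier_vecI; simp)+
  have y1: "mat_adjoint X1 *\<^sub>v ?y = 0\<^sub>v q" using u by (simp add: mult_assoc_dim mult_vec_assoc_dim)
  have "mat_adjoint X2 *\<^sub>v ?y = (mat_adjoint X2 * P z * X1) *\<^sub>v u"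
    using u by (simp add: mult_assoc_dim mult_vec_assoc_dim)
  also have "\<dots> = 0\<^sub>v p"
  proof -
    have "mat_adjoint X2 * P z * X1 = 0\<^sub>m p q"
      using X2MX1 by (simp add: X2_P smult_mult_dim)
    then show ?thesis using u by simp
  qed
  finally have y2: "mat_adjoint X2 *\<^sub>v ?y = 0\<^sub>v p" .
  have "mat_adjoint X *\<^sub>v ?y = (mat_adjoint X1 *\<^sub>v ?y) @\<^sub>v (mat_adjoint X2 *\<^sub>v ?y)"
    using mat_mult_append[of "mat_adjoint X1" q n "mat_adjoint X2" p ?y] X1 X2 y
    by (simp add: mat_adjoint_block_row[OF X1 X2])
  also have "\<dots> = 0\<^sub>v n" unfolding y1 y2 using qp by (intro eq_vecI) auto
  finally have "mat_adjoint X *\<^sub>v ?y = 0\<^sub>v n" .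
  moreover have "?y = M * X * mat_adjoint X *\<^sub>v ?y"
    using y by (simp add: m_unitary_right_inverse[OF carriers(1) m_unitary_X])
  moreover have "M * X * mat_adjoint X *\<^sub>v ?y = M * X *\<^sub>v (mat_adjoint X *\<^sub>v ?y)"
    by (rule mult_vec_assoc_dim) simp_all
  moreover have "M * X *\<^sub>v 0\<^sub>v n = 0\<^sub>v n" using qp by simp
  ultimately have "?y = 0\<^sub>v n" by simp
  then have "(z\<^sup>2 \<cdot>\<^sub>m M + K) *\<^sub>v ?v = 0\<^sub>v n" "D *\<^sub>v ?v = 0\<^sub>v n"
    using undamped_kernel[OF carriers(1) self_adjoint(1) D carriers(3) self_adjoint(3) omega z v] by auto
  moreover have "z\<^sup>2 = (\<i> * complex_of_real \<omega>)\<^sup>2" using z by auto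
  ultimately obtain w where w: "w \<in> carrier_vec p" "?v = X2 *\<^sub>v w"
    using kernel_in_range[OF v] by auto
  \<comment> \<open>\<open>X1 u\<close> also lies in the range of \<open>X2\<close>, so testing it
    against \<open>X1\<close> in the \<open>M\<close> inner product returns both \<open>u\<close>
    and zero.\<close>
  have "u = (mat_adjoint X1 * M * X1) *\<^sub>v u" using u by (simp add: X1MX1)
  also have "\<dots> = (mat_adjoint X1 * M) *\<^sub>v ?v"
    using u by (intro mult_vec_assoc_dim) simp_all
  also have "\<dots> = (mat_adjoint X1 * M * X2) *\<^sub>v w"
    unfolding w(2) using w(1) by (intro mult_vec_assoc_dim[symmetric]) simp_all
  also have "\<dots> = 0\<^sub>v q" using w(1) by (simp add: X1MX2)
  finally show False using u(2) by simp
qed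

text \<open>Away from the two undamped points the determinants differ by nonzero factors, one of
  them \<open>z\<^sup>2 + \<omega>\<^sup>2\<close> to the power \<open>p\<close>. At those points
  \<open>Ptilde_det_nonzero\<close> decides.\<close>

lemma eigvals_Ptilde:
  "eigvals (\<lambda>z. mat_adjoint X1 * P z * X1)
    = eigvals P - {\<i> * complex_of_real \<omega>, - (\<i> * complex_of_real \<omega>)}"
proof -
  have "det (mat_adjoint X1 * P z * X1) = 0 \<longleftrightarrow> det (P z) = 0"
    if "z \<notin> {\<i> * complex_of_real \<omega>, - (\<i> * complex_of_real \<omega>)}" for z
  proof -
    have "z\<^sup>2 + (complex_of_real \<omega>)\<^sup>2 = (z - \<i> * complex_of_real \<omega>) * (z + \<i> * complex_of_real \<omega>)"
      by (simp add: algebra_simps power2_eq_square)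
    also have "\<dots> \<noteq> 0" using that by (auto simp: add_eq_0_iff2)
    finally have nz: "z\<^sup>2 + (complex_of_real \<omega>)\<^sup>2 \<noteq> 0" .
    have c: "mat_adjoint X1 * P z * X1 \<in> carrier_mat q q" by (rule carrier_matI) simp_all
    have "det (mat_adjoint X * P z * X) = det (mat_adjoint X1 * P z * X1) * (z\<^sup>2 + (complex_of_real \<omega>)\<^sup>2) ^ p"
      unfolding block_diag_P by (simp add: det_diag2[OF c, of _ p])
    then show ?thesis
      using nz m_unitary_det_congruence[OF carriers(1) m_unitary_X, of "P z"] carriers by simp
  qed
  then show ?thesis using Ptilde_det_nonzero by (auto simp: eigvals_def)
qed

text \<open>The determinant factors over the two blocks. The first factor is nonzero by
  \<open>Ptilde_det_nonzero\<close>, the second because \<open>z\<close> has real part zero.\<close>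

lemma damped_not_eigenvalue:
  assumes H: "pos_def p H" and t: "0 < t"
    and z: "z \<in> {\<i> * complex_of_real \<omega>, - (\<i> * complex_of_real \<omega>)}"
  shows "z \<notin> eigvals (\<lambda>z. P z + (z * complex_of_real t) \<cdot>\<^sub>m (M * X2 * H * mat_adjoint X2 * M))"
proof -
  let ?c = "z * complex_of_real t"
  let ?G = "M * X2 * H * mat_adjoint X2 * M"
  let ?L = "z\<^sup>2 \<cdot>\<^sub>m 1\<^sub>m p + ?c \<cdot>\<^sub>m H + (complex_of_real \<omega>)\<^sup>2 \<cdot>\<^sub>m 1\<^sub>m p"
  note [simp] = carrier_matD[OF pos_defD(1)[OF H]]
  have c: "mat_adjoint X1 * P z * X1 \<in> carrier_mat q q" "?L \<in> carrier_mat p p"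
    "P z + ?c \<cdot>\<^sub>m ?G \<in> carrier_mat n n" by (rule carrier_matI; simp)+
  have "det ?L \<noteq> 0"
    using damped_eigenvalue_Re_neg[OF H t omega, of z] z by (auto simp: eigvals_def)
  then have "det (mat_adjoint X * (P z + ?c \<cdot>\<^sub>m ?G) * X) \<noteq> 0"
    using Ptilde_det_nonzero[OF z]
    by (simp add: block_diag_damped[OF pos_defD(1)[OF H]] det_diag2[OF c(1,2)])
  then show ?thesis
    using m_unitary_det_congruence[OF carriers(1) m_unitary_X c(3)] by (simp add: eigvals_def)
qed

end

section \<open>From the QR factorization to the null space, the congruence and the low-rank
  damping\<close>

theorem theorem29:
  fixes M D K Q Q1 Q2 R :: "complex mat" and n p :: nat and \<omega> :: real
  assumes M: "pos_def n M" and D: "pos_semidef n D" and K: "pos_semidef n K"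
    and omega: "\<omega> \<noteq> 0"
    and eig: "\<i> * complex_of_real \<omega> \<in> eigvals (quad_poly M D K)"
    and mult: "kernel_dim (quad_poly M D K (\<i> * complex_of_real \<omega>)) = p"
    and Q: "unitary_mat n Q" "Q = block_row Q1 Q2"
    and Q1: "Q1 \<in> carrier_mat n (n - p)" and Q2: "Q2 \<in> carrier_mat n p"
    and R: "R \<in> carrier_mat (n - p) (2 * n)" "vec_space.rank (n - p) R = n - p"
    and QR: "mat_adjoint Q * block_row ((\<i> * complex_of_real \<omega>)\<^sup>2 \<cdot>\<^sub>m M + K) D
               = R @\<^sub>r 0\<^sub>m p (2 * n)"
  shows
    "vec_space.col_space n Q2
       = mat_kernel (quad_poly M D K (\<i> * complex_of_real \<omega>))
     \<and>
     (\<forall>T. pos_def p T \<longrightarrow>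
        (let P = quad_poly M D K;
             Phat = (\<lambda>t :: real. \<lambda>z. P z + (z * complex_of_real t) \<cdot>\<^sub>m
                       (M * Q2 * T * mat_adjoint Q2 * M));
             B = mat_adjoint Q2 * M * Q2;
             That = mat_sqrt B * T * mat_sqrt B;
             X2 = Q2 * mat_inv_sqrt B;
             L = (\<lambda>t :: real. \<lambda>z. z\<^sup>2 \<cdot>\<^sub>m 1\<^sub>m p + (z * complex_of_real t) \<cdot>\<^sub>m That
                       + (complex_of_real \<omega>)\<^sup>2 \<cdot>\<^sub>m 1\<^sub>m p)
         in (\<exists>X1 \<in> carrier_mat n (n - p).
               let X = block_row X1 X2;
                   Ptilde = (\<lambda>z. mat_adjoint X1 * P z * X1)
               in m_unitary n M X
                  \<and> (\<forall>t > 0. \<forall>z.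
                       mat_adjoint X * P z * X
                         = diag_block_mat [Ptilde z, (z\<^sup>2 + (complex_of_real \<omega>)\<^sup>2) \<cdot>\<^sub>m 1\<^sub>m p]
                       \<and> mat_adjoint X * Phat t z * X = diag_block_mat [Ptilde z, L t z])
                  \<and> eigvals Ptilde
                      = eigvals P - {\<i> * complex_of_real \<omega>, - (\<i> * complex_of_real \<omega>)})
            \<and> (\<forall>t > 0. \<forall>z \<in> eigvals (L t). Re z < 0)
            \<and> (\<forall>t > 0. \<i> * complex_of_real \<omega> \<notin> eigvals (Phat t)
                      \<and> - (\<i> * complex_of_real \<omega>) \<notin> eigvals (Phat t))))
     \<and>
     (\<forall>m W. W \<in> carrier_mat n m \<and> vec_space.rank n W = m \<and> m < p \<longrightarrow>
        (let Pt = (\<lambda>t :: real. \<lambda>z. quad_poly M D K z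
                       + (z * complex_of_real t) \<cdot>\<^sub>m (W * mat_adjoint W))
         in \<forall>t > 0. \<i> * complex_of_real \<omega> \<in> eigvals (Pt t)
                   \<and> - (\<i> * complex_of_real \<omega>) \<in> eigvals (Pt t)))"
proof (intro conjI allI impI)
  let ?z = "\<i> * complex_of_real \<omega>"
  let ?P0 = "?z\<^sup>2 \<cdot>\<^sub>m M + K"
  note M' = pos_defD[OF M] and D' = pos_semidefD[OF D] and K' = pos_semidefD[OF K]
  note [simp] = carrier_matD[OF M'(1)] carrier_matD[OF D'(1)] carrier_matD[OF K'(1)]
    carrier_matD[OF Q1] carrier_matD[OF Q2]
  note U = unitary_block_row[OF Q(1)[unfolded Q(2)] Q1 Q2]
  have P0: "?P0 \<in> carrier_mat n n" "mat_adjoint ?P0 = ?P0"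
    using M'(1) K'(1) by (simp_all add: mat_adjoint_add mat_adjoint_smult M'(2) K'(2))
  have A: "block_row ?P0 D \<in> carrier_mat n (2 * n)"
    using block_row_carrier[OF P0(1) D'(1)] by (simp add: mult_2)
  note QR' = QR_null_space[OF Q(1)[unfolded Q(2)] Q1 Q2 A R QR[unfolded Q(2)]]
  have "block_row (mat_adjoint Q2 * ?P0) (mat_adjoint Q2 * D) = 0\<^sub>m p (n + n)"
    using QR'(1) mult_block_row[OF mat_adjoint_carrier[OF Q2] P0(1) D'(1)] by (simp add: mult_2)
  moreover have "mat_adjoint Q2 * ?P0 \<in> carrier_mat p n" "mat_adjoint Q2 * D \<in> carrier_mat p n"
    by (rule carrier_matI; simp)+
  ultimately have "mat_adjoint Q2 * ?P0 = 0\<^sub>m p n" "mat_adjoint Q2 * D = 0\<^sub>m p n"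
    by (rule block_row_eq_zeroD)+
  \<comment> \<open>Both matrices are Hermitian, so taking adjoints turns the left null space into
    the right one.\<close>
  from this[THEN arg_cong[of _ _ mat_adjoint]]
  have P0Q2: "?P0 * Q2 = 0\<^sub>m n p" and DQ2: "D * Q2 = 0\<^sub>m n p"
    using P0(2) by (simp_all add: mat_adjoint_mult D'(2))
  have ker: "v = Q2 *\<^sub>v (mat_adjoint Q2 *\<^sub>v v)"
    if v: "v \<in> carrier_vec n" "?P0 *\<^sub>v v = 0\<^sub>v n" "D *\<^sub>v v = 0\<^sub>v n" for v
  proof (rule QR'(2)[OF v(1)])
    have "mat_adjoint (block_row ?P0 D) *\<^sub>v v = (?P0 *\<^sub>v v) @\<^sub>v (D *\<^sub>v v)"
      using mat_mult_append[OF P0(1) D'(1) v(1)] by (simp only: mat_adjoint_block_row[OF P0(1) D'(1)] P0(2) D'(2))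
    also have "\<dots> = 0\<^sub>v (2 * n)" unfolding v(2,3) by (intro eq_vecI) auto
    finally show "mat_adjoint (block_row ?P0 D) *\<^sub>v v = 0\<^sub>v (2 * n)" .
  qed
  have range: "?P0 *\<^sub>v (Q2 *\<^sub>v u) = 0\<^sub>v n" "D *\<^sub>v (Q2 *\<^sub>v u) = 0\<^sub>v n" if "u \<in> carrier_vec p" for u
  proof -
    have "?P0 *\<^sub>v (Q2 *\<^sub>v u) = (?P0 * Q2) *\<^sub>v u" "D *\<^sub>v (Q2 *\<^sub>v u) = (D * Q2) *\<^sub>v u"
      by (rule mult_vec_assoc_dim[symmetric]; use that in simp)+
    then show "?P0 *\<^sub>v (Q2 *\<^sub>v u) = 0\<^sub>v n" "D *\<^sub>v (Q2 *\<^sub>v u) = 0\<^sub>v n"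
      using that by (simp_all only: P0Q2 DQ2 zero_mult_vec_dim carrier_vecD)
  qed
  have inj2: "b = 0\<^sub>v p" if b: "b \<in> carrier_vec p" "Q2 *\<^sub>v b = 0\<^sub>v n" for b
  proof -
    have "b = mat_adjoint Q2 *\<^sub>v (Q2 *\<^sub>v b)"
      using b(1) by (simp flip: mult_vec_assoc_dim add: U(4))
    then show ?thesis by (simp add: b(2))
  qed
  note undamped = undamped_kernel[OF M'(1,2) D K'(1,2) omega]
  show "vec_space.col_space n Q2 = mat_kernel (quad_poly M D K ?z)"
  proof -
    interpret vec_space "TYPE(complex)" n .
    have P: "quad_poly M D K ?z \<in> carrier_mat n n" using M'(1) D'(1) K'(1) by simp
    have "(\<exists>x\<in>carrier_vec p. Q2 *\<^sub>v x = v) \<longleftrightarrow> quad_poly M D K ?z *\<^sub>v v = 0\<^sub>v n"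
      if v: "v \<in> carrier_vec n" for v
    proof -
      have "mat_adjoint Q2 *\<^sub>v v \<in> carrier_vec p" by (rule carrier_vecI) simp
      then show ?thesis
        using undamped[of ?z v] v ker[OF v] range by (metis insertI1)
    qed
    then show ?thesis
      unfolding col_space_eq[OF Q2] mat_kernel[OF P] by auto
  qed
  show "let P = quad_poly M D K;
             Phat = (\<lambda>t :: real. \<lambda>z. P z + (z * complex_of_real t) \<cdot>\<^sub>m
                       (M * Q2 * T * mat_adjoint Q2 * M));
             B = mat_adjoint Q2 * M * Q2;
             That = mat_sqrt B * T * mat_sqrt B;
             X2 = Q2 * mat_inv_sqrt B;
             L = (\<lambda>t :: real. \<lambda>z. z\<^sup>2 \<cdot>\<^sub>m 1\<^sub>m p + (z * complex_of_real t) \<cdot>\<^sub>m That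
                       + (complex_of_real \<omega>)\<^sup>2 \<cdot>\<^sub>m 1\<^sub>m p)
         in (\<exists>X1 \<in> carrier_mat n (n - p).
               let X = block_row X1 X2;
                   Ptilde = (\<lambda>z. mat_adjoint X1 * P z * X1)
               in m_unitary n M X
                  \<and> (\<forall>t > 0. \<forall>z.
                       mat_adjoint X * P z * X
                         = diag_block_mat [Ptilde z, (z\<^sup>2 + (complex_of_real \<omega>)\<^sup>2) \<cdot>\<^sub>m 1\<^sub>m p]
                       \<and> mat_adjoint X * Phat t z * X = diag_block_mat [Ptilde z, L t z])
                  \<and> eigvals Ptilde
                      = eigvals P - {\<i> * complex_of_real \<omega>, - (\<i> * complex_of_real \<omega>)})
            \<and> (\<forall>t > 0. \<forall>z \<in> eigvals (L t). Re z < 0)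
            \<and> (\<forall>t > 0. \<i> * complex_of_real \<omega> \<notin> eigvals (Phat t)
                      \<and> - (\<i> * complex_of_real \<omega>) \<notin> eigvals (Phat t))"
    if T: "pos_def p T" for T
  proof -
    define B where "B = mat_adjoint Q2 * M * Q2"
    have B: "pos_def p B" unfolding B_def by (rule pos_def_congruence[OF M Q2 inj2])
    define S Y where "S = mat_sqrt B" and "Y = mat_inv_sqrt B"
    note S = mat_sqrt[OF B, folded S_def] and Y = mat_inv_sqrt[OF B, folded S_def Y_def]
    note S' = pos_defD[OF S(1)] and T' = pos_defD[OF T]
    note [simp] = carrier_matD[OF S'(1)] carrier_matD[OF Y(1)] carrier_matD[OF T'(1)]
      carrier_matD[OF pos_defD(1)[OF B]]
    define H where "H = S * T * S"
    have H: "pos_def p H"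
    proof -
      have "pos_def p (mat_adjoint S * T * S)"
        using pos_def_inj[OF S(1)] by (intro pos_def_congruence[OF T S'(1)]) auto
      then show ?thesis by (simp add: H_def S'(2))
    qed
    define X2 where "X2 = Q2 * Y"
    have X2: "X2 \<in> carrier_mat n p" by (rule carrier_matI) (simp_all add: X2_def)
    \<comment> \<open>Undoing the normalisation: \<open>X2\<close> and \<open>Q2\<close> have the
      same range, and \<open>Q2\<close> can be eliminated from the damping matrix.\<close>
    have X2S: "X2 * S = Q2" by (simp add: X2_def mult_assoc_dim Y(4))
    obtain X1 where X1: "X1 \<in> carrier_mat n (n - p)" "mat_adjoint X1 * M * X1 = 1\<^sub>m (n - p)"
        "mat_adjoint X1 * M * Q2 = 0\<^sub>m (n - p) p"
    proof (rule M_orthonormal_complement[OF M Q1 Q2 inj2])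
      fix a b assume ab: "a \<in> carrier_vec (n - p)" "b \<in> carrier_vec p" "Q1 *\<^sub>v a = Q2 *\<^sub>v b"
      \<comment> \<open>Standard orthogonality of \<open>Q1\<close> and \<open>Q2\<close> supplies
        the independence that the \<open>M\<close>-complement asks for.\<close>
      have "a = mat_adjoint Q1 *\<^sub>v (Q1 *\<^sub>v a)"
        using ab(1) by (simp flip: mult_vec_assoc_dim add: U(2))
      also have "\<dots> = (mat_adjoint Q1 * Q2) *\<^sub>v b"
        unfolding ab(3) using ab(2) by (intro mult_vec_assoc_dim[symmetric]) simp_all
      finally show "a = 0\<^sub>v (n - p)" using ab(2) by (simp add: U(3))
    qed
    note [simp] = carrier_matD[OF X1(1)] carrier_matD[OF X2]
    have KQ2: "K * Q2 = (complex_of_real \<omega>)\<^sup>2 \<cdot>\<^sub>m (M * Q2)"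
    proof (rule eq_matI)
      fix i j assume "i < dim_row ((complex_of_real \<omega>)\<^sup>2 \<cdot>\<^sub>m (M * Q2))"
        "j < dim_col ((complex_of_real \<omega>)\<^sup>2 \<cdot>\<^sub>m (M * Q2))"
      then have ij: "i < n" "j < p" by auto
      have "?z\<^sup>2 \<cdot>\<^sub>m (M * Q2) + K * Q2 = 0\<^sub>m n p"
        using P0Q2 by (simp add: mat_dim_simps)
      from arg_cong[OF this, of "\<lambda>A. A $$ (i, j)"]
      show "(K * Q2) $$ (i, j) = ((complex_of_real \<omega>)\<^sup>2 \<cdot>\<^sub>m (M * Q2)) $$ (i, j)"
        using ij by (simp add: power_mult_distrib algebra_simps eq_neg_iff_add_eq_0 del: index_mult_mat(1))
    qed simp_all
    interpret undamped_split n "n - p" p M D K X1 X2 \<omega>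
    proof
      \<comment> \<open>The subtraction truncates in general; that a unitary \<open>Q\<close> has
        exactly these columns forces \<open>p\<close> to be at most \<open>n\<close>.\<close>
      show "n - p + p = n" by (rule U(1))
      have "mat_adjoint X1 * M * X2 = (mat_adjoint X1 * M * Q2) * Y"
        by (simp add: X2_def mult_assoc_dim)
      then show "mat_adjoint X1 * M * X2 = 0\<^sub>m (n - p) p" by (simp add: X1(3))
      have "mat_adjoint X2 * M * X2 = Y * B * Y"
        by (simp add: X2_def B_def mat_adjoint_mult Y(2) mult_assoc_dim)
      then show "mat_adjoint X2 * M * X2 = 1\<^sub>m p" by (simp only: Y(5))
      have "D * X2 = (D * Q2) * Y" by (simp add: X2_def mult_assoc_dim)
      then show "D * X2 = 0\<^sub>m n p" by (simp add: DQ2)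
      have "K * X2 = (K * Q2) * Y" by (simp add: X2_def mult_assoc_dim)
      then show "K * X2 = (complex_of_real \<omega>)\<^sup>2 \<cdot>\<^sub>m (M * X2)"
        by (simp add: KQ2 X2_def mat_dim_simps)
      fix v assume v: "v \<in> carrier_vec n" "?P0 *\<^sub>v v = 0\<^sub>v n" "D *\<^sub>v v = 0\<^sub>v n"
      \<comment> \<open>The coordinates of \<open>v\<close> with respect to \<open>Q2\<close>,
        rescaled by the root to coordinates with respect to \<open>X2\<close>.\<close>
      let ?w = "S *\<^sub>v (mat_adjoint Q2 *\<^sub>v v)"
      have "X2 *\<^sub>v ?w = (X2 * S) *\<^sub>v (mat_adjoint Q2 *\<^sub>v v)"
        by (rule mult_vec_assoc_dim[symmetric]) simp_all
      then have "v = X2 *\<^sub>v ?w" using ker[OF v] by (simp only: X2S)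
      moreover have "?w \<in> carrier_vec p" by (rule carrier_vecI) simp
      ultimately show "\<exists>w\<in>carrier_vec p. v = X2 *\<^sub>v w" by blast
    qed (use M D K omega X1 X2 in simp_all)
    have G: "M * Q2 * T * mat_adjoint Q2 * M = M * X2 * H * mat_adjoint X2 * M"
    proof -
      have "M * Q2 * T * mat_adjoint Q2 * M = M * (X2 * S) * T * mat_adjoint (X2 * S) * M"
        by (simp only: X2S)
      also have "\<dots> = M * X2 * H * mat_adjoint X2 * M"
        by (simp add: H_def mat_adjoint_mult S'(2) mult_assoc_dim)
      finally show ?thesis .
    qed
    show ?thesis
      unfolding Let_def B_def[symmetric] S_def[symmetric] Y_def[symmetric] H_def[symmetric] X2_def[symmetric]
        G diag_block_mat_pair
      using X1(1) m_unitary_X block_diag_P block_diag_damped[OF pos_defD(1)[OF H]] eigvals_Ptilde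
        damped_eigenvalue_Re_neg[OF H _ omega] damped_not_eigenvalue[OF H]
      by (intro conjI bexI[of _ X1] allI impI ballI) simp_all
  qed
  show "let Pt = (\<lambda>t :: real. \<lambda>z. quad_poly M D K z
                       + (z * complex_of_real t) \<cdot>\<^sub>m (W * mat_adjoint W))
         in \<forall>t > 0. \<i> * complex_of_real \<omega> \<in> eigvals (Pt t)
                   \<and> - (\<i> * complex_of_real \<omega>) \<in> eigvals (Pt t)"
    if W: "W \<in> carrier_mat n m \<and> vec_space.rank n W = m \<and> m < p" for m W
  proof -
    have Wc: "W \<in> carrier_mat n m" using W by simp
    note [simp] = carrier_matD[OF Wc]
    have "mat_adjoint W * Q2 \<in> carrier_mat m p" by (rule carrier_matI) simp_all
    then obtain u where u: "u \<in> carrier_vec p" "u \<noteq> 0\<^sub>v p" "(mat_adjoint W * Q2) *\<^sub>v u = 0\<^sub>v m"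
      \<comment> \<open>Applied to the \<open>m\<close> by \<open>p\<close> product of the adjoint
        of \<open>W\<close> with \<open>Q2\<close>: \<open>u\<close> gives a vector of the undamped
        kernel on which the new damping vanishes.\<close>
      using wide_matrix_kernel W by metis
    let ?v = "Q2 *\<^sub>v u"
    have v: "?v \<in> carrier_vec n" by (rule carrier_vecI) simp
    have v0: "?v \<noteq> 0\<^sub>v n" using inj2[OF u(1)] u(2) by auto
    have Wv: "mat_adjoint W *\<^sub>v ?v = 0\<^sub>v m" using u by (simp add: mult_vec_assoc_dim)
    have "z \<in> eigvals (\<lambda>z. quad_poly M D K z + (z * c) \<cdot>\<^sub>m (W * mat_adjoint W))"
      if z: "z \<in> {?z, - ?z}" for z c
    proof -
      have P: "quad_poly M D K z \<in> carrier_mat n n" using M'(1) D'(1) K'(1) by simp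
      let ?A = "quad_poly M D K z + (z * c) \<cdot>\<^sub>m (W * mat_adjoint W)"
      \<comment> \<open>Both signs share this square, so the facts in \<open>range\<close> also
        serve the conjugate eigenvalue.\<close>
      have "z\<^sup>2 = ?z\<^sup>2" using z by auto
      then have "quad_poly M D K z *\<^sub>v ?v = 0\<^sub>v n"
        using undamped[OF z v] range[OF u(1)] by simp
      then have "?A *\<^sub>v ?v = 0\<^sub>v n"
        using carrier_matD[OF P] Wv by (simp add: mat_dim_simps smult_zero_vec_dim)
      moreover have "?A \<in> carrier_mat n n"
        using carrier_matD[OF P] by (intro carrier_matI) simp_all
      ultimately show ?thesis using v v0 det_0_iff_vec_prod_zero[of ?A n] by (auto simp: eigvals_def)
    qed
    then show ?thesis by (simp add: Let_def)
  qed
qed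

end
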